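(* Let $\kappa$ be an infinite cardinal, and for every $\zeta<\kappa$ let $B_\zeta$ be a nontrivial interval Boolean algebra. Then $\mathrm{Ind}\bigl(\prod_{\zeta<\kappa}B_\zeta\bigr)=2^\kappa$. Moreover, there are $n\in\omega$ and a nontrivial Boolean term $\tau(x_0,\dots,x_{n-1})$ such that for every family $\{a_\alpha : \alpha<(2^\kappa)^+\}\subseteq\prod_{\zeta<\kappa}B_\zeta$ there are ordinals $\alpha_0<\cdots<\alpha_{n-1}<(2^\kappa)^+$ such that $\tau(a_{\alpha_0},\dots,a_{\alpha_{n-1}})=0$ in $\prod_{\zeta<\kappa}B_\zeta$. In fact, $n$ can be taken to be $6$ and $\tau$ can be taken to be the term $$\tau(x_0,\dots,x_5)= x_0\cdot x_1\cdot(-x_2)\cdot(-x_3)\cdot x_4\cdot(-x_5).$$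
   Context: Operations in a Boolean algebra are written $\cdot$ (meet), $+$ (join), $-$ (complement). Products of Boolean algebras carry coordinatewise operations. Interval Boolean algebra: for a linear ordering $\langle I,<\rangle$ let $I^+=I\cup\{-\infty,\infty\}$, where $-\infty,\infty\notin I$ are new elements placed below and above all of $I$. For $s,t\in I^+$ let $[s,t)=\{x\in I : s\le x<t\}$. $B(I)$ is the subalgebra of the power set algebra $\mathcal P(I)$ generated by $\{[s,t): s,t\in I^+\}$. A Boolean algebra of the form $B(I)$ is called an interval Boolean algebra. It is nontrivial if $0\neq1$, i.e. if $I\ne\emptyset$. A Boolean term $\tau(x_1,\dots,x_n)$ is nontrivial if for some Boolean algebra $B$ and some $a_1,\dots,a_n\in B$ we have $\tau(a_1,\dots,a_n)\neq0$. A subset $X$ of a Boolean algebra $B$ is independent if for all pairwise distinct $a_1,\dots,a_n\in X$ and every nontrivial Boolean term $\tau(x_1,\dots,x_n)$ we have $\tau(a_1,\dots,a_n)\ne0$ in $B$. $\mathrm{Ind}(B)$ is the supremum of the cardinalities $|X|$ of independent subsets $X\subseteq B$. Families $\{a_\alpha:\alpha<(2^\kappa)^+\}$ are indexed families. $\mu^+$ denotes the successor cardinal of $\mu$. *)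

theory Defs
  imports "HOL-Analysis.Sigma_Algebra" "HOL-Library.Extended" "HOL-Library.FuncSet"
begin

unbundle cardinal_syntax

section \<open>Boolean algebras with explicit carrier\<close>

text \<open>The type class \<open>boolean_algebra\<close> does not cover subalgebras and products over an arbitrary
  index set, so Boolean algebras are records here. The trivial algebra is allowed.\<close>

record 'a balg =
  carrier :: "'a set"
  bmeet :: "'a \<Rightarrow> 'a \<Rightarrow> 'a"
  bjoin :: "'a \<Rightarrow> 'a \<Rightarrow> 'a"
  bcompl :: "'a \<Rightarrow> 'a"
  bzero :: 'a
  bone :: 'a

locale bool_alg =
  fixes B :: "'a balg"
  assumes zero_closed: "bzero B \<in> carrier B"
    and one_closed: "bone B \<in> carrier B"
    and meet_closed: "\<lbrakk>x \<in> carrier B; y \<in> carrier B\<rbrakk> \<Longrightarrow> bmeet B x y \<in> carrier B"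
    and join_closed: "\<lbrakk>x \<in> carrier B; y \<in> carrier B\<rbrakk> \<Longrightarrow> bjoin B x y \<in> carrier B"
    and compl_closed: "x \<in> carrier B \<Longrightarrow> bcompl B x \<in> carrier B"
    and meet_assoc: "\<lbrakk>x \<in> carrier B; y \<in> carrier B; z \<in> carrier B\<rbrakk>
          \<Longrightarrow> bmeet B (bmeet B x y) z = bmeet B x (bmeet B y z)"
    and join_assoc: "\<lbrakk>x \<in> carrier B; y \<in> carrier B; z \<in> carrier B\<rbrakk>
          \<Longrightarrow> bjoin B (bjoin B x y) z = bjoin B x (bjoin B y z)"
    and meet_comm: "\<lbrakk>x \<in> carrier B; y \<in> carrier B\<rbrakk> \<Longrightarrow> bmeet B x y = bmeet B y x"
    and join_comm: "\<lbrakk>x \<in> carrier B; y \<in> carrier B\<rbrakk> \<Longrightarrow> bjoin B x y = bjoin B y x"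
    and meet_absorb: "\<lbrakk>x \<in> carrier B; y \<in> carrier B\<rbrakk> \<Longrightarrow> bmeet B x (bjoin B x y) = x"
    and join_absorb: "\<lbrakk>x \<in> carrier B; y \<in> carrier B\<rbrakk> \<Longrightarrow> bjoin B x (bmeet B x y) = x"
    and meet_distrib: "\<lbrakk>x \<in> carrier B; y \<in> carrier B; z \<in> carrier B\<rbrakk>
          \<Longrightarrow> bmeet B x (bjoin B y z) = bjoin B (bmeet B x y) (bmeet B x z)"
    and join_distrib: "\<lbrakk>x \<in> carrier B; y \<in> carrier B; z \<in> carrier B\<rbrakk>
          \<Longrightarrow> bjoin B x (bmeet B y z) = bmeet B (bjoin B x y) (bjoin B x z)"
    and meet_compl: "x \<in> carrier B \<Longrightarrow> bmeet B x (bcompl B x) = bzero B"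
    and join_compl: "x \<in> carrier B \<Longrightarrow> bjoin B x (bcompl B x) = bone B"

definition nontrivial_balg :: "'a balg \<Rightarrow> bool" where
  "nontrivial_balg B \<longleftrightarrow> bzero B \<noteq> bone B"

definition set_balg :: "'a set \<Rightarrow> 'a set set \<Rightarrow> 'a set balg" where
  "set_balg \<Omega> M = \<lparr>carrier = M, bmeet = (\<inter>), bjoin = (\<union>), bcompl = (\<lambda>x. \<Omega> - x),
     bzero = {}, bone = \<Omega>\<rparr>"

definition prod_balg :: "'k set \<Rightarrow> ('k \<Rightarrow> 'a balg) \<Rightarrow> ('k \<Rightarrow> 'a) balg" where
  "prod_balg K B = \<lparr>carrier = (\<Pi>\<^sub>E \<zeta>\<in>K. carrier (B \<zeta>)),
     bmeet = (\<lambda>f g. \<lambda>\<zeta>\<in>K. bmeet (B \<zeta>) (f \<zeta>) (g \<zeta>)),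
     bjoin = (\<lambda>f g. \<lambda>\<zeta>\<in>K. bjoin (B \<zeta>) (f \<zeta>) (g \<zeta>)),
     bcompl = (\<lambda>f. \<lambda>\<zeta>\<in>K. bcompl (B \<zeta>) (f \<zeta>)),
     bzero = (\<lambda>\<zeta>\<in>K. bzero (B \<zeta>)),
     bone = (\<lambda>\<zeta>\<in>K. bone (B \<zeta>))\<rparr>"

lemma bool_alg_set_balg:
  assumes "algebra \<Omega> M"
  shows "bool_alg (set_balg \<Omega> M)"
proof -
  interpret algebra \<Omega> M by fact
  show ?thesis
    by unfold_locales (use sets_into_space in \<open>auto simp: set_balg_def\<close>)
qed

lemma bool_alg_prod_balg:
  assumes "\<And>\<zeta>. \<zeta> \<in> K \<Longrightarrow> bool_alg (B \<zeta>)"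
  shows "bool_alg (prod_balg K B)"
proof -
  have ext: "f = g" if "f \<in> extensional K" "g \<in> extensional K" "\<And>\<zeta>. \<zeta> \<in> K \<Longrightarrow> f \<zeta> = g \<zeta>" for f g
    using that by (rule extensionalityI)
  note closed = assms[THEN bool_alg.zero_closed] assms[THEN bool_alg.one_closed]
    assms[THEN bool_alg.meet_closed] assms[THEN bool_alg.join_closed]
    assms[THEN bool_alg.compl_closed]
  show ?thesis
  proof (unfold_locales, goal_cases)
    case 6
    then show ?case
      by (simp add: prod_balg_def PiE_iff)
        (intro ext, simp_all, use assms[THEN bool_alg.meet_assoc] in blast)
  next
    case 7
    then show ?case
      by (simp add: prod_balg_def PiE_iff)
        (intro ext, simp_all, use assms[THEN bool_alg.join_assoc] in blast)
  next
    case 8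
    then show ?case
      by (simp add: prod_balg_def PiE_iff)
        (intro ext, simp_all, use assms[THEN bool_alg.meet_comm] in blast)
  next
    case 9
    then show ?case
      by (simp add: prod_balg_def PiE_iff)
        (intro ext, simp_all, use assms[THEN bool_alg.join_comm] in blast)
  next
    case 10
    then show ?case
      by (simp add: prod_balg_def PiE_iff)
        (intro ext, simp_all, use assms[THEN bool_alg.meet_absorb] in blast)
  next
    case 11
    then show ?case
      by (simp add: prod_balg_def PiE_iff)
        (intro ext, simp_all, use assms[THEN bool_alg.join_absorb] in blast)
  next
    case 12
    then show ?case
      by (simp add: prod_balg_def PiE_iff)
        (intro ext, simp_all, use assms[THEN bool_alg.meet_distrib] in blast)
  next
    case 13
    then show ?case
      by (simp add: prod_balg_def PiE_iff)
        (intro ext, simp_all, use assms[THEN bool_alg.join_distrib] in blast)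
  next
    case 14
    then show ?case
      by (simp add: prod_balg_def PiE_iff)
        (intro ext, simp_all, use assms[THEN bool_alg.meet_compl] in blast)
  next
    case 15
    then show ?case
      by (simp add: prod_balg_def PiE_iff)
        (intro ext, simp_all, use assms[THEN bool_alg.join_compl] in blast)
  qed (simp_all add: prod_balg_def PiE_iff closed)
qed


section \<open>Interval Boolean algebras\<close>

text \<open>For a linear order \<open>r\<close> on \<open>I\<close>, given as a reflexive relation, \<open>ext_less r\<close> is the strict
  order of \<open>I\<^sup>+ = endpoints I\<close>.\<close>

fun ext_less :: "'i rel \<Rightarrow> 'i extended \<Rightarrow> 'i extended \<Rightarrow> bool" where
  "ext_less r (Fin x) (Fin y) \<longleftrightarrow> (x, y) \<in> r \<and> x \<noteq> y"
| "ext_less r Minf t \<longleftrightarrow> t \<noteq> Minf"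
| "ext_less r s Pinf \<longleftrightarrow> s \<noteq> Pinf"
| "ext_less r s t \<longleftrightarrow> False"

definition endpoints :: "'i set \<Rightarrow> 'i extended set" where
  "endpoints I = Fin ` I \<union> {Minf, Pinf}"

definition ico :: "'i set \<Rightarrow> 'i rel \<Rightarrow> 'i extended \<Rightarrow> 'i extended \<Rightarrow> 'i set" where
  "ico I r s t = {x \<in> I. (s = Fin x \<or> ext_less r s (Fin x)) \<and> ext_less r (Fin x) t}"

definition interval_balg :: "'i set \<Rightarrow> 'i rel \<Rightarrow> 'i set balg" where
  "interval_balg I r =
     set_balg I (algebra I hull {ico I r s t | s t. s \<in> endpoints I \<and> t \<in> endpoints I})"

definition is_interval_balg :: "'i set balg \<Rightarrow> bool" where
  "is_interval_balg B \<longleftrightarrow> (\<exists>I r. linear_order_on I r \<and> B = interval_balg I r)"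

lemma algebra_hull:
  assumes "G \<subseteq> Pow \<Omega>"
  shows "algebra \<Omega> (algebra \<Omega> hull G)"
proof -
  have P: "algebra \<Omega> (Pow \<Omega>)"
    by (auto simp: algebra_iff_Un)
  have "algebra \<Omega> hull G \<subseteq> Pow \<Omega>"
    unfolding hull_def using P assms by auto
  then show ?thesis
    unfolding algebra_iff_Un by (auto simp: hull_def algebra_iff_Un)
qed

lemma bool_alg_interval_balg: "is_interval_balg B \<Longrightarrow> bool_alg B"
  by (auto simp: is_interval_balg_def interval_balg_def ico_def
      intro!: bool_alg_set_balg algebra_hull)

lemma nontrivial_interval_balg: "nontrivial_balg (interval_balg I r) \<longleftrightarrow> I \<noteq> {}"
  by (auto simp: nontrivial_balg_def interval_balg_def set_balg_def)


section \<open>Boolean terms\<close>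

datatype bterm =
    BVar nat
  | BZero
  | BOne
  | BMeet bterm bterm
  | BJoin bterm bterm
  | BCompl bterm

instance bterm :: countable
  by countable_datatype

primrec bvars :: "bterm \<Rightarrow> nat set" where
  "bvars (BVar i) = {i}"
| "bvars BZero = {}"
| "bvars BOne = {}"
| "bvars (BMeet \<sigma> \<tau>) = bvars \<sigma> \<union> bvars \<tau>"
| "bvars (BJoin \<sigma> \<tau>) = bvars \<sigma> \<union> bvars \<tau>"
| "bvars (BCompl \<tau>) = bvars \<tau>"

primrec beval :: "'a balg \<Rightarrow> 'a list \<Rightarrow> bterm \<Rightarrow> 'a" where
  "beval B as (BVar i) = as ! i"
| "beval B as BZero = bzero B"
| "beval B as BOne = bone B"
| "beval B as (BMeet \<sigma> \<tau>) = bmeet B (beval B as \<sigma>) (beval B as \<tau>)"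
| "beval B as (BJoin \<sigma> \<tau>) = bjoin B (beval B as \<sigma>) (beval B as \<tau>)"
| "beval B as (BCompl \<tau>) = bcompl B (beval B as \<tau>)"

text \<open>\<open>nontrivial_bterm n \<tau>\<close>: \<open>\<tau>\<close> is a nontrivial term in the variables \<open>x\<^sub>0, \<dots>, x\<^sub>n\<^sub>-\<^sub>1\<close>. A definition
  cannot quantify over all types, so the witnessing algebra has its carrier in \<open>nat\<close>; by
  \<open>nontrivial_btermI\<close> below this loses no witness, whatever the type of its carrier.\<close>

definition nontrivial_bterm :: "nat \<Rightarrow> bterm \<Rightarrow> bool" where
  "nontrivial_bterm n \<tau> \<longleftrightarrow> bvars \<tau> \<subseteq> {..<n} \<and>
     (\<exists>(B :: nat balg) as. bool_alg B \<and> length as = n \<and> set as \<subseteq> carrier B \<and>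
        beval B as \<tau> \<noteq> bzero B)"

lemma beval_closed:
  assumes "bool_alg B" "set as \<subseteq> carrier B" "bvars \<tau> \<subseteq> {..<length as}"
  shows "beval B as \<tau> \<in> carrier B"
  using assms(3)
proof (induction \<tau>)
  case (BVar i)
  then show ?case using assms(2) nth_mem by fastforce
qed (use assms(1) in \<open>auto intro: bool_alg.zero_closed bool_alg.one_closed bool_alg.meet_closed
       bool_alg.join_closed bool_alg.compl_closed\<close>)

lemma nontrivial_btermI:
  fixes B :: "'a balg"
  assumes B: "bool_alg B" and as: "set as \<subseteq> carrier B"
    and \<tau>: "bvars \<tau> \<subseteq> {..<length as}" and ne: "beval B as \<tau> \<noteq> bzero B"
  shows "nontrivial_bterm (length as) \<tau>"
proof -
  define n where "n = length as"
  define T where "T = {\<sigma>. bvars \<sigma> \<subseteq> {..<n}}"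
  define S where "S = beval B as ` T"
  define f where "f = to_nat_on S"
  define g where "g = from_nat_into S"
  have "countable S" unfolding S_def by auto
  have gf: "g (f x) = x" if "x \<in> S" for x
    using that \<open>countable S\<close> by (simp add: f_def g_def)
  define C where "C = \<lparr>carrier = f ` S, bmeet = (\<lambda>x y. f (bmeet B (g x) (g y))),
     bjoin = (\<lambda>x y. f (bjoin B (g x) (g y))), bcompl = (\<lambda>x. f (bcompl B (g x))),
     bzero = f (bzero B), bone = f (bone B)\<rparr>"
  have SB: "x \<in> carrier B" if "x \<in> S" for x
    using that beval_closed[OF B as] by (auto simp: S_def T_def n_def)
  have S: "bzero B \<in> S" "bone B \<in> S"
      "\<And>x y. x \<in> S \<Longrightarrow> y \<in> S \<Longrightarrow> bmeet B x y \<in> S"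
      "\<And>x y. x \<in> S \<Longrightarrow> y \<in> S \<Longrightarrow> bjoin B x y \<in> S"
      "\<And>x. x \<in> S \<Longrightarrow> bcompl B x \<in> S"
  proof -
    have "beval B as BZero \<in> S" "beval B as BOne \<in> S"
      unfolding S_def by (rule imageI; simp add: T_def)+
    then show "bzero B \<in> S" "bone B \<in> S" by simp_all
  next
    fix x y assume "x \<in> S" "y \<in> S"
    then obtain \<rho> \<sigma> where *: "\<rho> \<in> T" "x = beval B as \<rho>" "\<sigma> \<in> T" "y = beval B as \<sigma>"
      by (auto simp: S_def)
    have "beval B as (BMeet \<rho> \<sigma>) \<in> S" "beval B as (BJoin \<rho> \<sigma>) \<in> S"
      unfolding S_def by (rule imageI; use * in \<open>simp add: T_def\<close>)+
    then show "bmeet B x y \<in> S" "bjoin B x y \<in> S" using * by simp_all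
  next
    fix x assume "x \<in> S"
    then obtain \<rho> where *: "\<rho> \<in> T" "x = beval B as \<rho>" by (auto simp: S_def)
    have "beval B as (BCompl \<rho>) \<in> S"
      unfolding S_def by (rule imageI; use * in \<open>simp add: T_def\<close>)
    then show "bcompl B x \<in> S" using * by simp
  qed
  have C: "bool_alg C"
  proof (unfold_locales, goal_cases)
    case 6
    then show ?case
      by (auto simp: C_def gf S intro!: arg_cong[where f = f] bool_alg.meet_assoc[OF B] SB)
  next
    case 7
    then show ?case
      by (auto simp: C_def gf S intro!: arg_cong[where f = f] bool_alg.join_assoc[OF B] SB)
  next
    case 8
    then show ?case
      by (auto simp: C_def gf S intro!: arg_cong[where f = f] bool_alg.meet_comm[OF B] SB)
  next
    case 9
    then show ?case
      by (auto simp: C_def gf S intro!: arg_cong[where f = f] bool_alg.join_comm[OF B] SB)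
  next
    case 10
    then show ?case
      by (auto simp: C_def gf S intro!: arg_cong[where f = f] bool_alg.meet_absorb[OF B] SB)
  next
    case 11
    then show ?case
      by (auto simp: C_def gf S intro!: arg_cong[where f = f] bool_alg.join_absorb[OF B] SB)
  next
    case 12
    then show ?case
      by (auto simp: C_def gf S intro!: arg_cong[where f = f] bool_alg.meet_distrib[OF B] SB)
  next
    case 13
    then show ?case
      by (auto simp: C_def gf S intro!: arg_cong[where f = f] bool_alg.join_distrib[OF B] SB)
  next
    case 14
    then show ?case
      by (auto simp: C_def gf S intro!: arg_cong[where f = f] bool_alg.meet_compl[OF B] SB)
  next
    case 15
    then show ?case
      by (auto simp: C_def gf S intro!: arg_cong[where f = f] bool_alg.join_compl[OF B] SB)
  qed (auto simp: C_def gf S)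
  have nS: "as ! i \<in> S" if "i < n" for i
  proof -
    have "beval B as (BVar i) \<in> S"
      unfolding S_def by (rule imageI; use that in \<open>simp add: T_def\<close>)
    then show ?thesis by simp
  qed
  have asS: "set as \<subseteq> S" using nS by (auto simp: in_set_conv_nth n_def)
  have ev: "beval C (map f as) \<sigma> = f (beval B as \<sigma>) \<and> beval B as \<sigma> \<in> S" if "\<sigma> \<in> T" for \<sigma>
    using that by (induction \<sigma>) (auto simp: T_def C_def gf S nS n_def[symmetric])
  have T: "\<tau> \<in> T" using \<tau> by (simp add: T_def n_def)
  have "beval C (map f as) \<tau> \<noteq> bzero C"
  proof
    assume "beval C (map f as) \<tau> = bzero C"
    then have "f (beval B as \<tau>) = f (bzero B)"
      using ev[OF T] by (simp add: C_def)
    then have "g (f (beval B as \<tau>)) = g (f (bzero B))" by simp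
    with ev[OF T] S(1) ne show False by (simp add: gf)
  qed
  moreover have "set (map f as) \<subseteq> carrier C" using asS by (auto simp: C_def)
  ultimately show ?thesis
    unfolding nontrivial_bterm_def using C \<tau>
    by (intro conjI exI[of _ C] exI[of _ "map f as"]) simp_all
qed


section \<open>Independence\<close>

definition independent_in :: "'a balg \<Rightarrow> 'a set \<Rightarrow> bool" where
  "independent_in B X \<longleftrightarrow> X \<subseteq> carrier B \<and>
     (\<forall>as \<tau>. distinct as \<longrightarrow> set as \<subseteq> X \<longrightarrow> nontrivial_bterm (length as) \<tau> \<longrightarrow>
        beval B as \<tau> \<noteq> bzero B)"

text \<open>The supremum of cardinals is only determined up to \<open>=o\<close>; \<open>Ind B\<close> is a representative on the
  type of elements of \<open>B\<close>, which is large enough because \<open>|carrier B|\<close> is an upper bound. By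
  \<open>Ind_least\<close> it is least among the upper bounds of all types.\<close>

definition is_Ind :: "'a balg \<Rightarrow> 'a rel \<Rightarrow> bool" where
  "is_Ind B c \<longleftrightarrow> Card_order c \<and> (\<forall>X. independent_in B X \<longrightarrow> |X| \<le>o c) \<and>
     (\<forall>d :: 'a rel. Card_order d \<longrightarrow> (\<forall>X. independent_in B X \<longrightarrow> |X| \<le>o d) \<longrightarrow> c \<le>o d)"

definition Ind :: "'a balg \<Rightarrow> 'a rel" where
  "Ind B = (SOME c. is_Ind B c)"

lemma is_Ind_Ind: "is_Ind B (Ind B)"
proof -
  let ?R = "{c :: 'a rel. Card_order c \<and> (\<forall>X. independent_in B X \<longrightarrow> |X| \<le>o c)}"
  have "|carrier B| \<in> ?R"
    by (auto simp: independent_in_def card_of_Card_order intro!: card_of_mono1)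
  then have "\<exists>r\<in>?R. \<forall>r'\<in>?R. r \<le>o r'"
    by (intro exists_minim_Card_order) auto
  then have "\<exists>c. is_Ind B c"
    unfolding is_Ind_def by blast
  then show ?thesis
    unfolding Ind_def by (rule someI_ex)
qed

lemma Ind_Card_order: "Card_order (Ind B)"
  using is_Ind_Ind by (auto simp: is_Ind_def)

lemma Ind_upper: "independent_in B X \<Longrightarrow> |X| \<le>o Ind B"
  using is_Ind_Ind by (auto simp: is_Ind_def)

lemma Ind_least:
  fixes d :: "'d rel"
  assumes d: "Card_order d" and ub: "\<And>X. independent_in B X \<Longrightarrow> |X| \<le>o d"
  shows "Ind B \<le>o d"
proof (rule ccontr)
  assume "\<not> Ind B \<le>o d"
  moreover have "Well_order d" "Well_order (Ind B)"
    using d Ind_Card_order[of B] by (simp_all add: card_order_on_def)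
  ultimately have "d <o Ind B"
    using not_ordLeq_iff_ordLess by blast
  then have "|Field d| \<le>o |Field (Ind B)|"
    by (simp add: card_of_mono2 ordLess_imp_ordLeq)
  then obtain f where f: "inj_on f (Field d)" "f ` Field d \<subseteq> Field (Ind B)"
    by (auto simp: card_of_ordLeq[symmetric])
  have "|Field d| =o |f ` Field d|"
    using card_of_ordIso inj_on_imp_bij_betw[OF f(1)] by blast
  then have e: "|f ` Field d| =o d"
    using card_of_Field_ordIso[OF d] by (rule ordIso_transitive[OF ordIso_symmetric])
  have "|X| \<le>o |f ` Field d|" if "independent_in B X" for X
    using ub[OF that] e ordIso_symmetric ordLeq_ordIso_trans by blast
  then have "Ind B \<le>o |f ` Field d|"
    using is_Ind_Ind[of B] card_of_Card_order unfolding is_Ind_def by blast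
  then have "Ind B \<le>o d" using e ordLeq_ordIso_trans by blast
  with \<open>\<not> Ind B \<le>o d\<close> show False ..
qed


definition tau6 :: bterm where
  "tau6 = BMeet (BMeet (BMeet (BMeet (BMeet (BVar 0) (BVar 1)) (BCompl (BVar 2)))
            (BCompl (BVar 3))) (BVar 4)) (BCompl (BVar 5))"

end

theory Submission
  imports Defs
begin

text \<open>
  \<^bold>\<open>Upper bound.\<close> An element of an interval algebra is a union of fibres of a monotone map \<open>N\<close>
  from the order to the naturals (\<open>interval_balg_monotone_fibres\<close>). It is thus described by a set \<open>p\<close>
  of naturals and the decreasing sequence of up-sets \<open>U l = {y. l < N y}\<close>, and all up-sets of a
  linear order form a chain. The term is \<open>\<tau>(x\<^sub>0, \<dots>, x\<^sub>5)\<close> with the pattern \<open>110 010\<close> of signs, to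
  be read as two triples that differ in the first sign, while the other two signs are different from
  each other. Suppose that for a triple the sequences of the second and the third element are placed in
  the same way with respect to the sequence of the first. If a point \<open>y\<close> belongs to exactly one of
  the second and the third element, then it is squeezed between
  corresponding members of their sequences. Hence the position of \<open>y\<close> with respect to the first element depends only on that place. If another triple
  has the same place and the same \<open>p\<close>, then \<open>y\<close> belongs to both first elements or to none, and the
  term vanishes (\<open>positions_agree\<close>, \<open>tau6_vanishes_somewhere\<close>).

  It remains to find two such triples that work in all \<open>\<kappa>\<close> coordinates at once among any \<open>(2\<^sup>\<kappa>)\<^sup>+\<close>
  elements (\<open>exist_similar_triples\<close>). There are \<open>2\<^sup>\<kappa>\<close> possible placements of one element relative
  to another, too many to hope for homogeneous sets of pairs, but a triple of the kind above and a
  second one of equal type only need the pigeonhole principle for \<open>(2\<^sup>\<kappa>)\<^sup>+\<close> and \<open>2\<^sup>\<kappa>\<close>. What needs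
  more care is that \<open>y\<close> may be squeezed at different levels of the sequences in the two triples. For
  this the levels are cut into blocks, such that members of different blocks are separated by
  up-sets common to all six elements, and the placement has to be constant on each block. If the first
  element of a triple violates this, then its sequence separates consecutive levels within a block.
  But when more and more separators are admitted, each of the \<open>\<kappa>\<close> many pairs of consecutive levels
  is cut for the first time only once, so among more than \<open>\<kappa>\<close> steps there is one at which nothing is
  cut. An element from such a step shows which placement can be used for both triples.

  \<^bold>\<open>Lower bound.\<close> An independent family of \<open>2\<^sup>\<kappa>\<close> subsets of \<open>\<kappa>\<close> gives independent elements of
  the product with values zero and one. Independence of sets speaks of truth values, independence in
  algebras of terms that do not vanish in some algebra; the two agree by \<open>nontrivial_bterm_satisfiable\<close>.
\<close>

section \<open>Cardinalities\<close>

lemma countable_card_le: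
  assumes "Cinfinite \<kappa>" "countable X" shows "|X| \<le>o \<kappa>"
proof -
  have "|X| \<le>o |UNIV :: nat set|"
    using countableE[OF assms(2)] by (metis card_of_ordLeqI UNIV_I)
  also have "|UNIV :: nat set| \<le>o |Field \<kappa>|"
    using assms(1) by (simp add: cinfinite_def infinite_iff_card_of_nat)
  also have "|Field \<kappa>| =o \<kappa>"
    using assms(1) by (simp add: card_of_Field_ordIso)
  finally show ?thesis .
qed

lemma Cinfinite_ctwo_cexp:
  fixes \<kappa> :: "'k rel"
  shows "Cinfinite \<kappa> \<Longrightarrow> Cinfinite (ctwo ^c \<kappa>)"
  by (simp add: Cinfinite_cexp ordLeq_refl ctwo_def card_of_Card_order)

lemma card_of_Field_Times_countable:
  assumes "Cinfinite \<kappa>" "countable X" shows "|Field \<kappa> \<times> X| \<le>o \<kappa>"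
  using assms countable_card_le[OF assms] by (intro card_of_Times_ordLeq_infinite_Field)
    (auto simp: cinfinite_def card_of_Field_ordIso ordIso_imp_ordLeq)

text \<open>The reason is \<open>(2\<^sup>\<kappa>)\<^sup>\<kappa> = 2\<^sup>\<kappa>\<^sup>\<cdot>\<^sup>\<kappa>\<close>. The types of indices and the colours of pairs of indices
  used below are functions of this kind, so \<open>(2\<^sup>\<kappa>)\<^sup>+\<close> indices can be thinned out until they agree.\<close>

lemma card_of_extensional_funcs_le:
  fixes \<kappa> :: "'k rel"
  assumes \<kappa>: "Cinfinite \<kappa>" and A: "|A| \<le>o \<kappa>" and B: "|B| \<le>o ctwo ^c \<kappa>"
  shows "|A \<rightarrow>\<^sub>E B| \<le>o ctwo ^c \<kappa>"
proof -
  have \<mu>: "Cinfinite (ctwo ^c \<kappa>)"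
    using \<kappa> by (rule Cinfinite_ctwo_cexp)
  show ?thesis
  proof (cases "A = {}")
    case True
    then have "|A \<rightarrow>\<^sub>E B| \<le>o |Field (ctwo ^c \<kappa>)|"
      using \<mu> by (simp add: card_of_singl_ordLeq cinfinite_def infinite_imp_nonempty)
    then show ?thesis
      using \<mu> card_of_Field_ordIso ordLeq_ordIso_trans by blast
  next
    case False
    have "A \<rightarrow>\<^sub>E B = Func A B"
      by (auto simp: PiE_def Pi_def extensional_def Func_def)
    then have "|A \<rightarrow>\<^sub>E B| =o |B| ^c |A|"
      unfolding cexp_def by (simp add: Field_card_of card_of_refl)
    also have "|B| ^c |A| \<le>o (ctwo ^c \<kappa>) ^c \<kappa>"
      using False by (intro cexp_mono' A B) (simp add: Field_card_of)
    also have "(ctwo ^c \<kappa>) ^c \<kappa> =o ctwo ^c (\<kappa> *c \<kappa>)"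
      by (rule cexp_cprod) (simp add: ctwo_def card_of_Card_order)
    also have "ctwo ^c (\<kappa> *c \<kappa>) =o ctwo ^c \<kappa>"
      using \<kappa> by (intro cexp_cong2 cprod_infinite) (auto simp: ctwo_def card_of_Card_order Card_order_cprod)
    finally show ?thesis .
  qed
qed

text \<open>Finite subsets are ranges of lists, and there are no more lists of a fixed length than
  elements.\<close>

lemma card_of_Fpow_le:
  assumes "infinite A" shows "|Fpow A| \<le>o |A|"
proof -
  have len: "|{xs. set xs \<subseteq> A \<and> length xs = n}| \<le>o |A|" for n
  proof (induction n)
    case 0
    have "{xs. set xs \<subseteq> A \<and> length xs = 0} = {[]}" by auto
    then show ?case using assms by (simp add: card_of_singl_ordLeq infinite_imp_nonempty)
  next
    case (Suc n)
    have "{xs. set xs \<subseteq> A \<and> length xs = Suc n}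
        = (\<lambda>(x, xs). x # xs) ` (A \<times> {xs. set xs \<subseteq> A \<and> length xs = n})"
      by (auto simp: length_Suc_conv image_iff)
    then have "|{xs. set xs \<subseteq> A \<and> length xs = Suc n}| \<le>o |A \<times> {xs. set xs \<subseteq> A \<and> length xs = n}|"
      by (simp only: card_of_image)
    also have "|A \<times> {xs. set xs \<subseteq> A \<and> length xs = n}| \<le>o |A|"
      by (intro card_of_Sigma_ordLeq_infinite[OF assms]) (simp_all add: Suc ordIso_imp_ordLeq[OF card_of_refl])
    finally show ?case .
  qed
  have "Fpow A \<subseteq> set ` (\<Union>n. {xs. set xs \<subseteq> A \<and> length xs = n})"
    unfolding Fpow_def using finite_list by (fastforce simp: image_iff)
  then have "|Fpow A| \<le>o |\<Union>n. {xs. set xs \<subseteq> A \<and> length xs = n}|"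
    by (rule ordLeq_transitive[OF card_of_mono1 card_of_image])
  also have "|\<Union>n. {xs. set xs \<subseteq> A \<and> length xs = n}| \<le>o |A|"
    using assms len by (intro card_of_UNION_ordLeq_infinite) (auto simp: infinite_iff_card_of_nat[symmetric])
  finally show ?thesis .
qed

section \<open>Unbounded sets below a successor cardinal\<close>

locale successor_cardinal =
  fixes \<mu> :: "'m rel" and L :: "'m set rel"
  assumes \<mu>: "Cinfinite \<mu>" and L_def: "L = cardSuc \<mu>"
begin

lemma Card_order_L: "Card_order L"
  using \<mu> by (simp add: L_def cardSuc_Card_order)

lemma Well_order_L: "Well_order L"
  using Card_order_L by (simp add: card_order_on_def)

definition less :: "'m set \<Rightarrow> 'm set \<Rightarrow> bool"  (infix "\<prec>" 50) where
  "x \<prec> y \<longleftrightarrow> (x, y) \<in> L - Id"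

definition unbounded :: "'m set set \<Rightarrow> bool" where
  "unbounded X \<longleftrightarrow> (\<forall>b\<in>Field L. \<exists>x\<in>X. b \<prec> x)"

lemma less_trans: "x \<prec> y \<Longrightarrow> y \<prec> z \<Longrightarrow> x \<prec> z"
proof -
  have "trans L" "antisym L"
    using Well_order_L by (simp_all add: order_on_defs)
  then show "x \<prec> y \<Longrightarrow> y \<prec> z \<Longrightarrow> x \<prec> z"
    unfolding less_def by (metis DiffD1 DiffD2 DiffI antisymD pair_in_Id_conv transD)
qed

lemma less_total: "x \<in> Field L \<Longrightarrow> y \<in> Field L \<Longrightarrow> x \<noteq> y \<Longrightarrow> x \<prec> y \<or> y \<prec> x"
  using Well_order_L by (auto simp: less_def order_on_defs total_on_def)

lemma less_Field: "x \<prec> y \<Longrightarrow> x \<in> Field L \<and> y \<in> Field L"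
  by (auto simp: less_def Field_def)

lemma card_of_initial_segment:
  assumes "x \<in> Field L" shows "|{y. y \<prec> x}| \<le>o \<mu>"
proof -
  have "{y. y \<prec> x} = underS L x"
    by (auto simp: less_def underS_def)
  then show ?thesis
    using card_of_underS[OF Card_order_L assms] \<mu>
    by (simp add: L_def cardSuc_ordLeq_ordLess card_of_Card_order)
qed

lemma finite_card_le: "finite A \<Longrightarrow> |A| \<le>o \<mu>"
  using \<mu> by (intro ordLess_imp_ordLeq finite_ordLess_infinite card_of_Well_order)
    (auto simp: cinfinite_def card_order_on_def Field_card_of)

text \<open>Regularity of a successor cardinal, in the form in which it is used: the initial segments
  below \<open>\<mu>\<close> many points have size at most \<open>\<mu>\<close> each, so their union is not everything.\<close>

lemma strict_bound:
  assumes J: "|J| \<le>o \<mu>" and f: "\<And>j. j \<in> J \<Longrightarrow> f j \<in> Field L"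
  shows "\<exists>b\<in>Field L. \<forall>j\<in>J. f j \<prec> b"
proof -
  have "|{x. x \<prec> f j} \<union> {f j}| \<le>o \<mu>" if "j \<in> J" for j
    using card_of_initial_segment[OF f[OF that]] finite_card_le[of "{f j}"] \<mu>
    by (intro card_of_Un_ordLeq_infinite_Field) (auto simp: cinfinite_def)
  then have "|\<Union>j\<in>J. {x. x \<prec> f j} \<union> {f j}| \<le>o \<mu>"
    using J \<mu> by (intro card_of_UNION_ordLeq_infinite_Field) (auto simp: cinfinite_def)
  then have "|\<Union>j\<in>J. {x. x \<prec> f j} \<union> {f j}| <o L"
    using \<mu> by (simp add: L_def cardSuc_ordLeq_ordLess card_of_Card_order)
  then have *: "|\<Union>j\<in>J. {x. x \<prec> f j} \<union> {f j}| <o |Field L|"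
    using Card_order_L card_of_Field_ordIso ordIso_symmetric ordLess_ordIso_trans by blast
  have "\<not> Field L \<subseteq> (\<Union>j\<in>J. {x. x \<prec> f j} \<union> {f j})"
    using not_ordLess_ordLeq[OF *] card_of_mono1 by blast
  then obtain b where "b \<in> Field L" "\<And>j. j \<in> J \<Longrightarrow> \<not> b \<prec> f j \<and> b \<noteq> f j"
    by auto
  then show ?thesis
    using less_total f by metis
qed

lemma Field_L_nonempty: "Field L \<noteq> {}"
  using \<mu> by (simp add: L_def Field_cardSuc_not_empty)

lemma unbounded_Field: "unbounded (Field L)"
  unfolding unbounded_def
proof
  fix b assume "b \<in> Field L"
  then show "\<exists>x\<in>Field L. b \<prec> x"
    using strict_bound[of "{b}" id] finite_card_le[of "{b}"] by simp
qed

lemma unbounded_mono: "unbounded X \<Longrightarrow> X \<subseteq> Y \<Longrightarrow> unbounded Y"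
  unfolding unbounded_def by blast

lemma unbounded_nonempty: "unbounded X \<Longrightarrow> X \<noteq> {}"
  using Field_L_nonempty by (auto simp: unbounded_def)

lemma unbounded_UN:
  assumes "unbounded X" and V: "|V| \<le>o \<mu>" and f: "X \<subseteq> (\<Union>v\<in>V. Y v)"
  shows "\<exists>v\<in>V. unbounded (Y v)"
proof (rule ccontr)
  assume "\<not> ?thesis"
  then have "\<forall>v\<in>V. \<exists>b\<in>Field L. \<forall>x\<in>Y v. \<not> b \<prec> x"
    unfolding unbounded_def by simp
  then obtain b where b: "\<forall>v\<in>V. b v \<in> Field L \<and> (\<forall>x\<in>Y v. \<not> b v \<prec> x)"
    by (metis (no_types))
  then obtain c where c: "c \<in> Field L" "\<forall>v\<in>V. b v \<prec> c"
    using strict_bound[OF V, of b] by blast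
  then obtain x where x: "x \<in> X" "c \<prec> x"
    using \<open>unbounded X\<close> unfolding unbounded_def by blast
  then obtain v where "v \<in> V" "x \<in> Y v" using f by blast
  then show False
    using b c x less_trans by blast
qed

lemma unbounded_fibre:
  assumes "unbounded X" and "|V| \<le>o \<mu>" and "\<And>x. x \<in> X \<Longrightarrow> f x \<in> V"
  shows "\<exists>v\<in>V. unbounded {x \<in> X. f x = v}"
  by (rule unbounded_UN[OF assms(1,2)]) (use assms(3) in auto)

text \<open>Call a colour bad if only boundedly many \<open>\<alpha>\<close> repeat it unboundedly often. There are at most \<open>\<mu>\<close>
  colours, so all the bad ones together concern only boundedly many \<open>\<alpha>\<close>, and any other \<open>\<alpha>\<close> will do.
  What matters is that \<open>\<alpha>\<close> is found before it is known which of its colours will be of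
  interest.\<close>

lemma recurrent_colour:
  assumes X: "unbounded X" and V: "|V| \<le>o \<mu>"
    and c: "\<And>\<alpha> \<delta>. \<alpha> \<in> X \<Longrightarrow> \<delta> \<in> X \<Longrightarrow> c \<alpha> \<delta> \<in> V"
  shows "\<exists>\<alpha>\<in>X. \<forall>q. unbounded {\<delta> \<in> X. c \<alpha> \<delta> = q} \<longrightarrow>
           unbounded {\<beta> \<in> X. unbounded {\<delta> \<in> X. c \<beta> \<delta> = q}}"
proof (rule ccontr)
  define R where "R q = {\<beta> \<in> X. unbounded {\<delta> \<in> X. c \<beta> \<delta> = q}}" for q
  assume "\<not> ?thesis"
  then have *: "\<exists>q. \<alpha> \<in> R q \<and> \<not> unbounded (R q)" if "\<alpha> \<in> X" for \<alpha>
    using that by (auto simp: R_def)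
  have "q \<in> V" if "\<alpha> \<in> R q" for \<alpha> q
  proof -
    have "\<alpha> \<in> X" "{\<delta> \<in> X. c \<alpha> \<delta> = q} \<noteq> {}"
      using that unbounded_nonempty by (auto simp: R_def)
    then show ?thesis using c by auto
  qed
  with * have "X \<subseteq> (\<Union>q\<in>{q\<in>V. \<not> unbounded (R q)}. R q)"
    by blast
  moreover have "|{q\<in>V. \<not> unbounded (R q)}| \<le>o \<mu>"
    by (rule ordLeq_transitive[OF card_of_mono1 V]) auto
  ultimately show False
    using unbounded_UN[OF X] by blast
qed

text \<open>The intervals from \<open>G \<xi>\<close> to \<open>\<beta> (G \<xi>)\<close> are pairwise disjoint. The sequence does the work of an
  increasing chain of elementary submodels, where \<open>\<beta>\<close> bounds the witnesses that have to be added
  at each step.\<close>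

lemma sequence_closed_under:
  assumes \<beta>: "\<And>\<gamma>. \<gamma> \<in> Field L \<Longrightarrow> \<beta> \<gamma> \<in> Field L"
  shows "\<exists>G. (\<forall>\<xi>\<in>Field L. G \<xi> \<in> Field L) \<and> (\<forall>\<xi> \<eta>. \<xi> \<prec> \<eta> \<longrightarrow> \<beta> (G \<xi>) \<prec> G \<eta>)"
proof -
  define P where "P G \<eta> b \<longleftrightarrow> (\<eta> \<in> Field L \<longrightarrow> b \<in> Field L \<and> (\<forall>\<xi>. \<xi> \<prec> \<eta> \<longrightarrow> \<beta> (G \<xi>) \<prec> b))"
    for G \<eta> b
  have "\<exists>G. \<forall>\<eta>. P G \<eta> (G \<eta>)"
  proof (rule dependent_wf_choice)
    show "wf (L - Id)" using Well_order_L by (simp add: well_order_on_def)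
  next
    fix f g :: "'m set \<Rightarrow> 'm set" and x r
    assume "\<And>z. (z, x) \<in> L - Id \<Longrightarrow> f z = g z"
    then show "P f x r = P g x r" by (auto simp: P_def less_def)
  next
    fix x f assume *: "\<And>y. (y, x) \<in> L - Id \<Longrightarrow> P f y (f y)"
    have "\<beta> (f y) \<in> Field L" if "y \<in> {y. y \<prec> x}" for y
      using *[of y] that \<beta> less_Field[of y x] by (simp add: P_def less_def)
    then show "\<exists>r. P f x r"
      using strict_bound[of "{y. y \<prec> x}" "\<lambda>y. \<beta> (f y)"] card_of_initial_segment[of x]
      by (cases "x \<in> Field L") (auto simp: P_def)
  qed
  then obtain G where G: "\<And>\<eta>. P G \<eta> (G \<eta>)" by blast
  show ?thesis
  proof (intro exI[of _ G] conjI ballI allI impI)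
    fix \<xi> assume "\<xi> \<in> Field L"
    then show "G \<xi> \<in> Field L" using G[of \<xi>] by (simp add: P_def)
  next
    fix \<xi> \<eta> assume "\<xi> \<prec> \<eta>"
    then show "\<beta> (G \<xi>) \<prec> G \<eta>" using G[of \<eta>] less_Field by (simp add: P_def)
  qed
qed

end

section \<open>Two similar triples of decreasing sequences of sets\<close>

definition separates :: "'i set \<Rightarrow> (nat \<Rightarrow> 'i set) \<Rightarrow> nat \<Rightarrow> bool" where
  "separates V U l \<longleftrightarrow> U (Suc l) \<subseteq> V \<and> \<not> U l \<subseteq> V"

text \<open>For a decreasing sequence \<open>U\<close> the set \<open>{k. gap_of U V l k}\<close> is an initial segment of the
  naturals. It records the place of \<open>V l\<close> among the members of \<open>U\<close>, also when \<open>V l\<close> has no least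
  element that could be compared with these members.\<close>

definition gap_of :: "(nat \<Rightarrow> 'i set) \<Rightarrow> (nat \<Rightarrow> 'i set) \<Rightarrow> nat \<Rightarrow> nat \<Rightarrow> bool" where
  "gap_of U V l k \<longleftrightarrow> V l \<subseteq> U k"

text \<open>The sequences with numbers 0, 1, 2 and those with numbers 3, 4, 5 form the two triples. In both,
  the second and third sequence have the same gaps \<open>q\<close> with respect to the first. The partial
  function \<open>S\<close> of separators cuts the levels into blocks, at the same places for all six sequences;
  \<open>q\<close> has to be constant on each block.\<close>

definition similar_triples :: "'i set set \<Rightarrow> (nat \<Rightarrow> nat \<Rightarrow> 'i set) \<Rightarrow> bool" where
  "similar_triples \<U> U \<longleftrightarrow> (\<exists>S q.
     (\<forall>l V. S l = Some V \<longrightarrow> V \<in> \<U> \<and> (\<forall>j<6. separates V (U j) l)) \<and>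
     (\<forall>l. S l = None \<longrightarrow> q (Suc l) = q l) \<and>
     (\<forall>(i, j) \<in> {(0, 1), (0, 2), (3, 4), (3, 5)}. gap_of (U i) (U j) = q))"

text \<open>Think of \<open>\<gamma>\<close> as a stage at which only the sequences with index below \<open>\<gamma>\<close> are known. The type
  of \<open>\<delta>\<close> at stage \<open>\<gamma>\<close> consists of \<open>p \<delta>\<close> and of chosen separators from stage \<open>\<gamma>\<close> for consecutive
  members of \<open>U \<delta>\<close>, where they exist. The function \<open>\<beta>\<close> leads from \<open>\<gamma>\<close> to a later stage that contains
  a typical index of each type at stage \<open>\<gamma>\<close> that occurs unboundedly often. For fixed \<open>\<delta>\<close> a pair of
  consecutive members becomes separated at most once, and there are only \<open>\<kappa>\<close> such pairs; so among
  more than \<open>\<kappa>\<close> disjoint intervals from \<open>G \<xi>\<close> to \<open>\<beta> (G \<xi>)\<close> there is one in which no new pair of \<open>\<delta>\<close>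
  becomes separated. For unboundedly many \<open>\<delta>\<close> this interval and the type agree. Then the typical index
  \<open>\<alpha>\<close> of that type lies in the interval and separates nothing new, which says that the gaps of \<open>\<delta>\<close>
  with respect to \<open>\<alpha>\<close> are constant on blocks. As \<open>\<alpha>\<close> is typical, the same gaps occur unboundedly often,
  and so two triples with these gaps are found, one after the other.\<close>

lemma exist_similar_triples:
  fixes \<kappa> :: "'k rel" and U :: "('k \<Rightarrow> bool) set \<Rightarrow> 'k \<Rightarrow> nat \<Rightarrow> 'i set"
    and p :: "('k \<Rightarrow> bool) set \<Rightarrow> 'k \<Rightarrow> nat set"
  defines "L \<equiv> cardSuc (ctwo ^c \<kappa>)"
  assumes \<kappa>: "Cinfinite \<kappa>"
    and dec: "\<And>\<alpha> \<zeta> l. \<alpha> \<in> Field L \<Longrightarrow> \<zeta> \<in> Field \<kappa> \<Longrightarrow> U \<alpha> \<zeta> (Suc l) \<subseteq> U \<alpha> \<zeta> l"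
  shows "\<exists>\<alpha>s. length \<alpha>s = 6 \<and> set \<alpha>s \<subseteq> Field L \<and> sorted_wrt (\<lambda>\<alpha> \<beta>. (\<alpha>, \<beta>) \<in> L - Id) \<alpha>s \<and>
    (\<forall>\<zeta>\<in>Field \<kappa>. (\<exists>P. \<forall>\<alpha>\<in>set \<alpha>s. p \<alpha> \<zeta> = P) \<and>
       similar_triples {V. \<exists>\<alpha>\<in>Field L. V \<in> range (U \<alpha> \<zeta>)} (\<lambda>j. U (\<alpha>s ! j) \<zeta>))"
proof -
  let ?\<mu> = "ctwo ^c \<kappa>"
  have \<mu>: "Cinfinite ?\<mu>"
    using \<kappa> by (rule Cinfinite_ctwo_cexp)
  interpret successor_cardinal ?\<mu> L
    using \<mu> by unfold_locales (simp_all add: L_def)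
  have \<kappa>\<mu>: "\<kappa> <o ?\<mu>"
    using \<kappa> by (simp add: ordLess_ctwo_cexp)

  \<comment> \<open>A separator is recorded by its index and level, which bounds the number of candidates
    below \<open>\<gamma>\<close> by \<open>2\<^sup>\<kappa>\<close>, uniformly in all coordinates.\<close>
  define sep where "sep \<gamma> \<delta> \<zeta> l =
      (if \<exists>\<alpha> k. \<alpha> \<prec> \<gamma> \<and> separates (U \<alpha> \<zeta> k) (U \<delta> \<zeta>) l
       then Some (SOME (\<alpha>, k). \<alpha> \<prec> \<gamma> \<and> separates (U \<alpha> \<zeta> k) (U \<delta> \<zeta>) l) else None)" for \<gamma> \<delta> \<zeta> l
  have sep_Some: "\<alpha> \<prec> \<gamma> \<and> separates (U \<alpha> \<zeta> k) (U \<delta> \<zeta>) l" if "sep \<gamma> \<delta> \<zeta> l = Some (\<alpha>, k)" for \<alpha> \<gamma> \<delta> \<zeta> k l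
  proof -
    have ex: "\<exists>x. case x of (\<alpha>, k) \<Rightarrow> \<alpha> \<prec> \<gamma> \<and> separates (U \<alpha> \<zeta> k) (U \<delta> \<zeta>) l"
      using that by (auto simp: sep_def split: if_splits)
    have "(SOME (\<alpha>, k). \<alpha> \<prec> \<gamma> \<and> separates (U \<alpha> \<zeta> k) (U \<delta> \<zeta>) l) = (\<alpha>, k)"
      using that by (simp add: sep_def split: if_splits)
    then show ?thesis using someI_ex[OF ex] by simp
  qed
  have sep_None: "\<not> separates (U \<alpha> \<zeta> k) (U \<delta> \<zeta>) l" if "sep \<gamma> \<delta> \<zeta> l = None" "\<alpha> \<prec> \<gamma>" for \<alpha> \<gamma> \<delta> \<zeta> k l
    using that by (auto simp: sep_def split: if_splits)

  define T where "T \<gamma> \<delta> = (\<lambda>(\<zeta>, l)\<in>Field \<kappa> \<times> (UNIV :: nat set). (l \<in> p \<delta> \<zeta>, sep \<gamma> \<delta> \<zeta> l))" for \<gamma> \<delta>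
  define TT where "TT \<gamma> = (Field \<kappa> \<times> (UNIV :: nat set)) \<rightarrow>\<^sub>E
      (UNIV :: bool set) \<times> insert None (Some ` ({\<alpha>. \<alpha> \<prec> \<gamma>} \<times> (UNIV :: nat set)))" for \<gamma>
  have T_TT: "T \<gamma> \<delta> \<in> TT \<gamma>" for \<gamma> \<delta>
  proof -
    have "sep \<gamma> \<delta> \<zeta> l \<in> insert None (Some ` ({\<alpha>. \<alpha> \<prec> \<gamma>} \<times> (UNIV :: nat set)))" for \<zeta> l
      using sep_Some[of \<gamma> \<delta> \<zeta> l] by (cases "sep \<gamma> \<delta> \<zeta> l") auto
    then show ?thesis unfolding T_def TT_def by auto
  qed
  have TT_le: "|TT \<gamma>| \<le>o ?\<mu>" if \<gamma>: "\<gamma> \<in> Field L" for \<gamma>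
  proof -
    have "|{\<alpha>. \<alpha> \<prec> \<gamma>} \<times> (UNIV :: nat set)| \<le>o ?\<mu>"
      using \<mu> card_of_initial_segment[OF \<gamma>] countable_card_le[OF \<mu>, of "UNIV :: nat set"]
      by (intro card_of_Times_ordLeq_infinite_Field) (auto simp: cinfinite_def)
    then have "|Some ` ({\<alpha>. \<alpha> \<prec> \<gamma>} \<times> (UNIV :: nat set))| \<le>o ?\<mu>"
      by (rule ordLeq_transitive[OF card_of_image])
    then have "|{None} \<union> Some ` ({\<alpha>. \<alpha> \<prec> \<gamma>} \<times> (UNIV :: nat set))| \<le>o ?\<mu>"
      using \<mu> finite_card_le[of "{None}"]
      by (intro card_of_Un_ordLeq_infinite_Field) (auto simp: cinfinite_def)
    then have "|(UNIV :: bool set) \<times> insert None (Some ` ({\<alpha>. \<alpha> \<prec> \<gamma>} \<times> (UNIV :: nat set)))| \<le>o ?\<mu>"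
      using \<mu> finite_card_le[of "UNIV :: bool set"]
      by (intro card_of_Times_ordLeq_infinite_Field) (auto simp: cinfinite_def)
    then show ?thesis
      unfolding TT_def
      by (intro card_of_extensional_funcs_le[OF \<kappa> card_of_Field_Times_countable[OF \<kappa>]]) simp_all
  qed
  \<comment> \<open>The colour of a pair collects the gaps in all coordinates.\<close>
  define C where "C \<alpha> \<delta> = (\<lambda>(\<zeta>, l, k)\<in>Field \<kappa> \<times> (UNIV :: (nat \<times> nat) set).
      gap_of (U \<alpha> \<zeta>) (U \<delta> \<zeta>) l k)" for \<alpha> \<delta>
  define CC where "CC = (Field \<kappa> \<times> (UNIV :: (nat \<times> nat) set)) \<rightarrow>\<^sub>E (UNIV :: bool set)"
  have C_CC: "C \<alpha> \<delta> \<in> CC" for \<alpha> \<delta>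
    unfolding C_def CC_def by auto
  have CC_le: "|CC| \<le>o ?\<mu>"
    unfolding CC_def using finite_card_le[of "UNIV :: bool set"]
    by (intro card_of_extensional_funcs_le[OF \<kappa> card_of_Field_Times_countable[OF \<kappa>]]) simp_all

  define R where "R \<gamma> t = {\<delta> \<in> Field L. T \<gamma> \<delta> = t}" for \<gamma> t
  define typical where "typical \<gamma> t \<alpha> \<longleftrightarrow> \<alpha> \<in> R \<gamma> t \<and>
      (\<forall>q. unbounded {\<delta> \<in> R \<gamma> t. C \<alpha> \<delta> = q} \<longrightarrow>
           unbounded {\<beta> \<in> R \<gamma> t. unbounded {\<delta> \<in> R \<gamma> t. C \<beta> \<delta> = q}})" for \<gamma> t \<alpha>
  have "\<exists>\<alpha>. typical \<gamma> t \<alpha>" if "unbounded (R \<gamma> t)" for \<gamma> t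
    using recurrent_colour[OF that CC_le, of C] C_CC unfolding typical_def by auto
  then obtain h where h: "\<And>\<gamma> t. unbounded (R \<gamma> t) \<Longrightarrow> typical \<gamma> t (h \<gamma> t)"
    by metis
  have "\<exists>b\<in>Field L. \<forall>t. unbounded (R \<gamma> t) \<longrightarrow> h \<gamma> t \<prec> b" if \<gamma>: "\<gamma> \<in> Field L" for \<gamma>
  proof -
    have "|{t. unbounded (R \<gamma> t)}| \<le>o |TT \<gamma>|"
    proof (rule card_of_mono1, rule subsetI)
      fix t assume "t \<in> {t. unbounded (R \<gamma> t)}"
      then obtain \<delta> where "\<delta> \<in> R \<gamma> t" using unbounded_nonempty by blast
      then show "t \<in> TT \<gamma>" using T_TT by (auto simp: R_def)
    qed
    then have "|{t. unbounded (R \<gamma> t)}| \<le>o ?\<mu>"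
      by (rule ordLeq_transitive[OF _ TT_le[OF \<gamma>]])
    moreover have "h \<gamma> t \<in> Field L" if "unbounded (R \<gamma> t)" for t
      using h[OF that] by (simp add: typical_def R_def)
    ultimately show ?thesis
      using strict_bound[of "{t. unbounded (R \<gamma> t)}" "h \<gamma>"] by simp
  qed
  then obtain \<beta> where \<beta>: "\<And>\<gamma>. \<gamma> \<in> Field L \<Longrightarrow> \<beta> \<gamma> \<in> Field L"
      "\<And>\<gamma> t. \<gamma> \<in> Field L \<Longrightarrow> unbounded (R \<gamma> t) \<Longrightarrow> h \<gamma> t \<prec> \<beta> \<gamma>"
    by metis
  obtain G where G: "\<And>\<xi>. \<xi> \<in> Field L \<Longrightarrow> G \<xi> \<in> Field L"
      "\<And>\<xi> \<eta>. \<xi> \<prec> \<eta> \<Longrightarrow> \<beta> (G \<xi>) \<prec> G \<eta>"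
    using sequence_closed_under[of \<beta>] \<beta>(1) by blast
  \<comment> \<open>The size of \<open>K0\<close> has to exceed \<open>\<kappa>\<close>, but must allow to thin out along maps into \<open>K0\<close>.\<close>
  obtain K0 where K0: "K0 \<subseteq> Field L" "|K0| =o ?\<mu>"
  proof -
    have "?\<mu> \<le>o L" using \<mu> by (simp add: L_def cardSuc_ordLeq)
    then have "|Field ?\<mu>| \<le>o |Field L|" by (rule card_of_mono2)
    then obtain g where g: "inj_on g (Field ?\<mu>)" "g ` Field ?\<mu> \<subseteq> Field L"
      unfolding card_of_ordLeq[symmetric] by blast
    have "|Field ?\<mu>| =o |g ` Field ?\<mu>|"
      by (rule card_of_ordIsoI[OF inj_on_imp_bij_betw[OF g(1)]])
    moreover have "|Field ?\<mu>| =o ?\<mu>" using \<mu> by (simp add: card_of_Field_ordIso)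
    ultimately have "|g ` Field ?\<mu>| =o ?\<mu>"
      by (rule ordIso_transitive[OF ordIso_symmetric])
    then show thesis using that g(2) by blast
  qed

  \<comment> \<open>Otherwise every \<open>\<xi> \<in> K0\<close> has its own pair \<open>z \<xi>\<close> that becomes separated between \<open>G \<xi>\<close> and
    \<open>\<beta> (G \<xi>)\<close>, which embeds \<open>K0\<close> into a set of size \<open>\<kappa>\<close>.\<close>
  have stable: "\<exists>\<xi>\<in>K0. \<forall>\<zeta>\<in>Field \<kappa>. \<forall>l. sep (G \<xi>) \<delta> \<zeta> l = None \<longrightarrow> sep (\<beta> (G \<xi>)) \<delta> \<zeta> l = None" for \<delta>
  proof (rule ccontr)
    assume "\<not> ?thesis"
    then have "\<forall>\<xi>\<in>K0. \<exists>z\<in>Field \<kappa> \<times> UNIV. sep (G \<xi>) \<delta> (fst z) (snd z) = None \<and>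
        sep (\<beta> (G \<xi>)) \<delta> (fst z) (snd z) \<noteq> None"
      by fastforce
    then obtain z where z: "\<And>\<xi>. \<xi> \<in> K0 \<Longrightarrow> z \<xi> \<in> Field \<kappa> \<times> (UNIV :: nat set)"
        "\<And>\<xi>. \<xi> \<in> K0 \<Longrightarrow> sep (G \<xi>) \<delta> (fst (z \<xi>)) (snd (z \<xi>)) = None"
        "\<And>\<xi>. \<xi> \<in> K0 \<Longrightarrow> sep (\<beta> (G \<xi>)) \<delta> (fst (z \<xi>)) (snd (z \<xi>)) \<noteq> None"
      by metis
    have ne: "z \<xi> \<noteq> z \<eta>" if "\<xi> \<in> K0" "\<eta> \<in> K0" "\<xi> \<prec> \<eta>" for \<xi> \<eta>
    proof
      assume eq: "z \<xi> = z \<eta>"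
      obtain \<alpha> k where "sep (\<beta> (G \<xi>)) \<delta> (fst (z \<xi>)) (snd (z \<xi>)) = Some (\<alpha>, k)"
        using z(3)[OF \<open>\<xi> \<in> K0\<close>] by auto
      from sep_Some[OF this] show False
        using sep_None[OF z(2)[OF \<open>\<eta> \<in> K0\<close>], of \<alpha> k] G(2)[OF \<open>\<xi> \<prec> \<eta>\<close>] less_trans eq by metis
    qed
    have "inj_on z K0"
      by (rule inj_onI) (use ne less_total K0(1) in \<open>metis subsetD\<close>)
    then have "|K0| \<le>o |Field \<kappa> \<times> (UNIV :: nat set)|"
      using z(1) by (intro card_of_ordLeqI) auto
    also have "|Field \<kappa> \<times> (UNIV :: nat set)| \<le>o \<kappa>"
      by (rule card_of_Field_Times_countable[OF \<kappa>]) simp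
    finally have "|K0| \<le>o \<kappa>" .
    then have "?\<mu> \<le>o \<kappa>"
      by (rule ordIso_ordLeq_trans[OF ordIso_symmetric[OF K0(2)]])
    then show False using \<kappa>\<mu> not_ordLess_ordLeq by blast
  qed
  then obtain \<xi> where \<xi>: "\<And>\<delta>. \<xi> \<delta> \<in> K0"
      "\<And>\<delta> \<zeta> l. \<zeta> \<in> Field \<kappa> \<Longrightarrow> sep (G (\<xi> \<delta>)) \<delta> \<zeta> l = None \<Longrightarrow> sep (\<beta> (G (\<xi> \<delta>))) \<delta> \<zeta> l = None"
    by metis
  \<comment> \<open>Thin out three times: equal interval, equal type, equal gaps with respect to \<open>\<alpha>\<close>.\<close>
  obtain x where x: "x \<in> K0" "unbounded {\<delta> \<in> Field L. \<xi> \<delta> = x}"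
    using unbounded_fibre[OF unbounded_Field ordIso_imp_ordLeq[OF K0(2)], of \<xi>] \<xi>(1) by blast
  define \<gamma> where "\<gamma> = G x"
  have \<gamma>: "\<gamma> \<in> Field L" using x K0 G by (auto simp: \<gamma>_def)
  obtain t where t: "unbounded {\<delta> \<in> {\<delta> \<in> Field L. \<xi> \<delta> = x}. T \<gamma> \<delta> = t}"
    using unbounded_fibre[OF x(2) TT_le[OF \<gamma>], of "T \<gamma>"] T_TT by blast
  then have "unbounded (R \<gamma> t)"
    by (rule unbounded_mono) (auto simp: R_def)
  define \<alpha> where "\<alpha> = h \<gamma> t"
  have \<alpha>: "typical \<gamma> t \<alpha>" "\<alpha> \<prec> \<beta> \<gamma>"
    using h[OF \<open>unbounded (R \<gamma> t)\<close>] \<beta>(2)[OF \<gamma> \<open>unbounded (R \<gamma> t)\<close>] by (simp_all add: \<alpha>_def)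
  obtain c where c: "unbounded {\<delta> \<in> {\<delta> \<in> {\<delta> \<in> Field L. \<xi> \<delta> = x}. T \<gamma> \<delta> = t}. C \<alpha> \<delta> = c}"
    using unbounded_fibre[OF t CC_le, of "C \<alpha>"] C_CC by blast
  then have "unbounded {\<delta> \<in> R \<gamma> t. C \<alpha> \<delta> = c}"
    by (rule unbounded_mono) (auto simp: R_def)
  then have first: "unbounded {\<beta> \<in> R \<gamma> t. unbounded {\<delta> \<in> R \<gamma> t. C \<beta> \<delta> = c}}"
    using \<alpha>(1) by (simp add: typical_def)
  obtain \<delta> where \<delta>: "\<xi> \<delta> = x" "T \<gamma> \<delta> = t" "C \<alpha> \<delta> = c" "\<delta> \<in> Field L"
    using unbounded_nonempty[OF c] by blast

  \<comment> \<open>Here \<open>\<delta>\<close> is only a sample from which the common data are read off.\<close>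
  define P where "P \<zeta> = p \<delta> \<zeta>" for \<zeta>
  define S where "S \<zeta> l = map_option (\<lambda>(\<alpha>, k). U \<alpha> \<zeta> k) (sep \<gamma> \<delta> \<zeta> l)" for \<zeta> l
  have S_Some: "\<exists>\<eta> k. sep \<gamma> \<delta> \<zeta> l = Some (\<eta>, k) \<and> V = U \<eta> \<zeta> k" if "S \<zeta> l = Some V" for \<zeta> l V
    using that by (cases "sep \<gamma> \<delta> \<zeta> l") (auto simp: S_def)
  define q where "q \<zeta> = gap_of (U \<alpha> \<zeta>) (U \<delta> \<zeta>)" for \<zeta>
  have T_eq: "(l \<in> p \<epsilon> \<zeta>) = (l \<in> P \<zeta>) \<and> sep \<gamma> \<epsilon> \<zeta> l = sep \<gamma> \<delta> \<zeta> l"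
    if "\<epsilon> \<in> R \<gamma> t" "\<zeta> \<in> Field \<kappa>" for \<epsilon> \<zeta> l
  proof -
    have "T \<gamma> \<epsilon> (\<zeta>, l) = T \<gamma> \<delta> (\<zeta>, l)" using that \<delta>(2) by (simp add: R_def)
    then show ?thesis using that(2) by (simp add: T_def P_def)
  qed
  have C_eq: "gap_of (U \<eta> \<zeta>) (U \<epsilon> \<zeta>) = q \<zeta>" if "C \<eta> \<epsilon> = c" "\<zeta> \<in> Field \<kappa>" for \<eta> \<epsilon> \<zeta>
  proof (intro ext)
    fix l k
    have "C \<eta> \<epsilon> (\<zeta>, l, k) = C \<alpha> \<delta> (\<zeta>, l, k)" using that \<delta>(3) by simp
    then show "gap_of (U \<eta> \<zeta>) (U \<epsilon> \<zeta>) l k = q \<zeta> l k" using that(2) by (simp add: C_def q_def)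
  qed

  have next_in: "\<exists>y\<in>Y. x \<prec> y" if "unbounded Y" "x \<in> Field L" for x Y
    using that by (auto simp: unbounded_def)
  have R_L: "\<epsilon> \<in> Field L" if "\<epsilon> \<in> R \<gamma> t" for \<epsilon> using that by (simp add: R_def)
  obtain \<alpha>0 where \<alpha>0: "\<alpha>0 \<in> R \<gamma> t" "unbounded {\<delta> \<in> R \<gamma> t. C \<alpha>0 \<delta> = c}"
    using unbounded_nonempty[OF first] by blast
  obtain \<alpha>1 where \<alpha>1: "\<alpha>1 \<in> R \<gamma> t" "C \<alpha>0 \<alpha>1 = c" "\<alpha>0 \<prec> \<alpha>1"
    using next_in[OF \<alpha>0(2) R_L[OF \<alpha>0(1)]] by blast
  obtain \<alpha>2 where \<alpha>2: "\<alpha>2 \<in> R \<gamma> t" "C \<alpha>0 \<alpha>2 = c" "\<alpha>1 \<prec> \<alpha>2"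
    using next_in[OF \<alpha>0(2) R_L[OF \<alpha>1(1)]] by blast
  obtain \<alpha>3 where \<alpha>3: "\<alpha>3 \<in> R \<gamma> t" "unbounded {\<delta> \<in> R \<gamma> t. C \<alpha>3 \<delta> = c}" "\<alpha>2 \<prec> \<alpha>3"
    using next_in[OF first R_L[OF \<alpha>2(1)]] by blast
  obtain \<alpha>4 where \<alpha>4: "\<alpha>4 \<in> R \<gamma> t" "C \<alpha>3 \<alpha>4 = c" "\<alpha>3 \<prec> \<alpha>4"
    using next_in[OF \<alpha>3(2) R_L[OF \<alpha>3(1)]] by blast
  obtain \<alpha>5 where \<alpha>5: "\<alpha>5 \<in> R \<gamma> t" "C \<alpha>3 \<alpha>5 = c" "\<alpha>4 \<prec> \<alpha>5"
    using next_in[OF \<alpha>3(2) R_L[OF \<alpha>4(1)]] by blast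
  define \<alpha>s where "\<alpha>s = [\<alpha>0, \<alpha>1, \<alpha>2, \<alpha>3, \<alpha>4, \<alpha>5]"
  have set_\<alpha>s: "\<epsilon> \<in> R \<gamma> t" if "\<epsilon> \<in> set \<alpha>s" for \<epsilon>
    using that \<alpha>0(1) \<alpha>1(1) \<alpha>2(1) \<alpha>3(1) \<alpha>4(1) \<alpha>5(1) by (auto simp: \<alpha>s_def)
  have len: "length \<alpha>s = 6" by (simp add: \<alpha>s_def)
  have "set \<alpha>s \<subseteq> Field L" using set_\<alpha>s R_L by blast
  have "sorted_wrt (\<lambda>\<alpha> \<beta>. (\<alpha>, \<beta>) \<in> L - Id) \<alpha>s"
  proof -
    have "transp (\<prec>)" by (rule transpI) (rule less_trans)
    then have "sorted_wrt (\<prec>) \<alpha>s"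
      using \<alpha>1(3) \<alpha>2(3) \<alpha>3(3) \<alpha>4(3) \<alpha>5(3)
      by (simp add: \<alpha>s_def sorted_wrt1 sorted_wrt2 del: sorted_wrt.simps)
    then show ?thesis by (simp add: less_def[abs_def])
  qed
  have same: "\<exists>P. \<forall>\<epsilon>\<in>set \<alpha>s. p \<epsilon> \<zeta> = P" if "\<zeta> \<in> Field \<kappa>" for \<zeta>
    using T_eq[OF set_\<alpha>s that] by blast
  have similar: "similar_triples {V. \<exists>\<alpha>\<in>Field L. V \<in> range (U \<alpha> \<zeta>)} (\<lambda>j. U (\<alpha>s ! j) \<zeta>)"
    if \<zeta>: "\<zeta> \<in> Field \<kappa>" for \<zeta>
    unfolding similar_triples_def
  proof (intro exI[of _ "S \<zeta>"] exI[of _ "q \<zeta>"] conjI allI impI)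
    fix l V assume "S \<zeta> l = Some V"
    then obtain \<eta> k where \<eta>: "sep \<gamma> \<delta> \<zeta> l = Some (\<eta>, k)" "V = U \<eta> \<zeta> k"
      using S_Some by blast
    show "V \<in> {V. \<exists>\<alpha>\<in>Field L. V \<in> range (U \<alpha> \<zeta>)}"
      using sep_Some[OF \<eta>(1)] \<eta>(2) less_Field by blast
    fix j :: nat assume "j < 6"
    then have "\<alpha>s ! j \<in> R \<gamma> t"
      using \<open>length \<alpha>s = 6\<close> by (intro set_\<alpha>s nth_mem) simp
    then show "separates V (U (\<alpha>s ! j) \<zeta>) l"
      using sep_Some[of \<gamma> "\<alpha>s ! j" \<zeta> l \<eta> k] T_eq \<zeta> \<eta> by simp
  next
    fix l assume "S \<zeta> l = None"
    then have "sep (\<beta> \<gamma>) \<delta> \<zeta> l = None"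
      using \<xi>(2)[OF \<zeta>, of \<delta> l] \<delta>(1) by (simp add: S_def \<gamma>_def)
    then have "\<not> separates (U \<alpha> \<zeta> k) (U \<delta> \<zeta>) l" for k
      using sep_None \<alpha>(2) by blast
    then show "q \<zeta> (Suc l) = q \<zeta> l"
      using dec[OF \<delta>(4) \<zeta>, of l] by (auto simp: separates_def q_def gap_of_def)
  next
    show "\<forall>(i, j) \<in> {(0, 1), (0, 2), (3, 4), (3, 5)}.
        gap_of (U (\<alpha>s ! i) \<zeta>) (U (\<alpha>s ! j) \<zeta>) = q \<zeta>"
      using C_eq \<zeta> \<alpha>1(2) \<alpha>2(2) \<alpha>4(2) \<alpha>5(2) by (auto simp: \<alpha>s_def)
  qed
  show ?thesis
    using len \<open>set \<alpha>s \<subseteq> Field L\<close> \<open>sorted_wrt (\<lambda>\<alpha> \<beta>. (\<alpha>, \<beta>) \<in> L - Id) \<alpha>s\<close>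
    by (intro exI[of _ \<alpha>s] conjI ballI same similar)
qed

section \<open>A point cannot tell two similar triples apart\<close>

text \<open>Read \<open>n j\<close> as the position of the point \<open>y\<close> relative to the sequence \<open>U j\<close>. If \<open>n 1 < n 2\<close>, then
  \<open>U 1 (n 1)\<close> and \<open>U 2 (n 1)\<close> enclose \<open>y\<close> in the chain, and since the two have the same gap with respect
  to \<open>U 0\<close>, this gap determines the position of \<open>y\<close> relative to \<open>U 0\<close>. The same happens in the second
  triple, possibly at another level. Both levels are in the same block, for a separator between them
  would both contain and omit \<open>y\<close>.\<close>

lemma positions_agree:
  fixes U :: "nat \<Rightarrow> nat \<Rightarrow> 'i set" and n :: "nat \<Rightarrow> nat"
  assumes chain: "\<And>X Y. X \<in> \<U> \<Longrightarrow> Y \<in> \<U> \<Longrightarrow> X \<subseteq> Y \<or> Y \<subseteq> X"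
    and U: "\<And>j l. j < 6 \<Longrightarrow> U j l \<in> \<U>"
    and n: "\<And>j l. j < 6 \<Longrightarrow> y \<in> U j l \<longleftrightarrow> l < n j"
    and similar: "similar_triples \<U> U"
    and ne: "n 1 \<noteq> n 2" "n 4 \<noteq> n 5"
  shows "n 0 = n 3"
proof -
  obtain S q where Sq: "\<forall>l V. S l = Some V \<longrightarrow> V \<in> \<U> \<and> (\<forall>j<6. separates V (U j) l)"
      "\<forall>l. S l = None \<longrightarrow> q (Suc l) = q l"
      "\<forall>(i, j) \<in> {(0, 1), (0, 2), (3, 4), (3, 5)}. gap_of (U i) (U j) = q"
    using similar unfolding similar_triples_def by (elim exE conjE)
  have S: "V \<in> \<U>" "j < 6 \<Longrightarrow> separates V (U j) l" if "S l = Some V" for l V j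
    using Sq(1) that by auto
  have gap: "gap_of (U 0) (U 1) = q" "gap_of (U 0) (U 2) = q" "gap_of (U 3) (U 4) = q"
      "gap_of (U 3) (U 5) = q"
    using Sq(3) by auto
  have const: "q l = q l'" if "l \<le> l'" and j: "j < 6" "n j \<le> l" and j': "j' < 6" "l' < n j'" for l l' j j'
    using \<open>l \<le> l'\<close> j'(2)
  proof (induction l' rule: dec_induct)
    case (step m)
    have "S m = None"
    proof (rule ccontr)
      assume "S m \<noteq> None"
      then obtain V where V: "S m = Some V" by auto
      have "\<not> U j m \<subseteq> V" using S(2)[OF V j(1)] by (simp add: separates_def)
      then have "V \<subseteq> U j m" using chain[OF S(1)[OF V] U[OF j(1)]] by auto
      moreover have "y \<notin> U j m" using n j step by simp
      moreover have "y \<in> V"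
        using S(2)[OF V j'(1)] n[OF j'(1), of "Suc m"] step by (auto simp: separates_def)
      ultimately show False by blast
    qed
    then show ?case using Sq(2) step by simp
  qed simp
  have triple: "\<exists>l. (\<forall>k. k < n i \<longleftrightarrow> q l k) \<and> (\<exists>j<6. n j \<le> l) \<and> (\<exists>j<6. l < n j)"
    if ijk: "i < 6" "a < 6" "b < 6" and less: "n a < n b"
      and gaps: "gap_of (U i) (U a) = q" "gap_of (U i) (U b) = q" for i a b
  proof -
    have "k < n i \<longleftrightarrow> q (n a) k" for k
    proof -
      have "y \<in> U b (n a)" "y \<notin> U a (n a)" using n ijk less by simp_all
      moreover have "U i k \<subseteq> U a (n a) \<or> U a (n a) \<subseteq> U i k"
        using chain U ijk by simp
      moreover have "q (n a) k \<longleftrightarrow> U a (n a) \<subseteq> U i k" "q (n a) k \<longleftrightarrow> U b (n a) \<subseteq> U i k"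
        using gaps[THEN fun_cong, THEN fun_cong, of "n a" k] by (simp_all add: gap_of_def)
      moreover have "k < n i \<longleftrightarrow> y \<in> U i k" using n ijk by simp
      ultimately show ?thesis by blast
    qed
    then show ?thesis using ijk less by (intro exI[of _ "n a"]) auto
  qed
  obtain l j1 j2 where l: "\<And>k. k < n 0 \<longleftrightarrow> q l k" "j1 < 6" "n j1 \<le> l" "j2 < 6" "l < n j2"
    using triple[of 0 1 2] triple[of 0 2 1] gap ne(1) by (auto simp: neq_iff)
  obtain l' j3 j4 where l': "\<And>k. k < n 3 \<longleftrightarrow> q l' k" "j3 < 6" "n j3 \<le> l'" "j4 < 6" "l' < n j4"
    using triple[of 3 4 5] triple[of 3 5 4] gap ne(2) by (auto simp: neq_iff)
  have "q l = q l'"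
    using const[OF _ l(2,3) l'(4,5)] const[OF _ l'(2,3) l(4,5)] nat_le_linear[of l l'] by metis
  then have "k < n 0 \<longleftrightarrow> k < n 3" for k using l(1)[of k] l'(1)[of k] by simp
  from this[of "n 0"] this[of "n 3"] show ?thesis by simp
qed

section \<open>Six elements on which the term vanishes\<close>

definition upset :: "'i set \<Rightarrow> 'i rel \<Rightarrow> 'i set \<Rightarrow> bool" where
  "upset I r X \<longleftrightarrow> X \<subseteq> I \<and> (\<forall>x\<in>X. \<forall>y\<in>I. (x, y) \<in> r \<longrightarrow> y \<in> X)"

lemma linear_order_on_total:
  assumes "linear_order_on I r" "x \<in> I" "y \<in> I" shows "(x, y) \<in> r \<or> (y, x) \<in> r"
  using assms by (cases "x = y") (auto simp: order_on_defs total_on_def refl_on_def)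

lemma upsets_chain:
  assumes "linear_order_on I r" "upset I r X" "upset I r Y"
  shows "X \<subseteq> Y \<or> Y \<subseteq> X"
proof (rule ccontr)
  assume "\<not> ?thesis"
  then obtain x y where "x \<in> X" "x \<notin> Y" "y \<in> Y" "y \<notin> X" by blast
  moreover have "x \<in> I" "y \<in> I"
    using assms(2,3) calculation by (auto simp: upset_def)
  moreover have "(x, y) \<in> r \<or> (y, x) \<in> r"
    using linear_order_on_total[OF assms(1)] calculation by blast
  ultimately show False using assms(2,3) unfolding upset_def by blast
qed

text \<open>This replaces the normal form as a finite union of intervals. The unions of fibres of monotone
  maps form an algebra of sets: for \<open>N\<close> and \<open>N'\<close> the map \<open>N + N'\<close> has as fibres the common
  refinement of both families of fibres, because by monotonicity \<open>N + N'\<close> cannot be equal at two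
  points unless both summands are.\<close>

lemma interval_balg_monotone_fibres:
  assumes r: "linear_order_on I r" and a: "a \<in> carrier (interval_balg I r)"
  shows "\<exists>(N :: 'i \<Rightarrow> nat) p. monotone_on I (\<lambda>x y. (x, y) \<in> r) (\<le>) N \<and> a = {x \<in> I. N x \<in> p}"
proof -
  define M where "M = {a. \<exists>(N :: 'i \<Rightarrow> nat) p. monotone_on I (\<lambda>x y. (x, y) \<in> r) (\<le>) N \<and> a = {x \<in> I. N x \<in> p}}"
  have trans: "(x, z) \<in> r" if "(x, y) \<in> r" "(y, z) \<in> r" for x y z
    using r that unfolding order_on_defs by (blast dest: transD)
  have antisym: "x = y" if "(x, y) \<in> r" "(y, x) \<in> r" for x y
    using r that unfolding order_on_defs by (blast dest: antisymD)
  have Un: "a \<union> b \<in> M" if ab: "a \<in> M" "b \<in> M" for a b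
  proof -
    obtain N N' :: "'i \<Rightarrow> nat" and p p' where N: "monotone_on I (\<lambda>x y. (x, y) \<in> r) (\<le>) N" "a = {x \<in> I. N x \<in> p}"
        "monotone_on I (\<lambda>x y. (x, y) \<in> r) (\<le>) N'" "b = {x \<in> I. N' x \<in> p'}"
      using ab unfolding M_def by blast
    have same: "N x = N z \<and> N' x = N' z" if "x \<in> I" "z \<in> I" "N x + N' x = N z + N' z" for x z
    proof -
      have "N x \<le> N z \<and> N' x \<le> N' z \<or> N z \<le> N x \<and> N' z \<le> N' x"
        using linear_order_on_total[OF r that(1,2)] N(1,3) that(1,2)
        unfolding monotone_on_def by blast
      then show ?thesis using that(3) by linarith
    qed
    have "a \<union> b = {x \<in> I. N x + N' x \<in> (\<lambda>x. N x + N' x) ` (a \<union> b)}"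
    proof (intro equalityI subsetI)
      fix x assume "x \<in> {x \<in> I. N x + N' x \<in> (\<lambda>x. N x + N' x) ` (a \<union> b)}"
      then obtain z where z: "x \<in> I" "z \<in> a \<union> b" "N x + N' x = N z + N' z" by auto
      then have "N x = N z \<and> N' x = N' z" using same[of x z] by (auto simp: N(2,4))
      then show "x \<in> a \<union> b" using z by (auto simp: N(2,4))
    qed (auto simp: N(2,4))
    moreover have "monotone_on I (\<lambda>x y. (x, y) \<in> r) (\<le>) (\<lambda>x. N x + N' x)"
      using N(1,3) by (auto simp: monotone_on_def intro: add_mono)
    ultimately show ?thesis unfolding M_def by blast
  qed
  have compl: "I - a \<in> M" if ab: "a \<in> M" for a
  proof -
    obtain N :: "'i \<Rightarrow> nat" and p where N: "monotone_on I (\<lambda>x y. (x, y) \<in> r) (\<le>) N" "a = {x \<in> I. N x \<in> p}"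
      using ab unfolding M_def by blast
    then have "I - a = {x \<in> I. N x \<in> - p}" by auto
    then show ?thesis unfolding M_def using N(1) by blast
  qed
  have up: "X \<in> M" if "upset I r X" for X
  proof -
    have "X = {x \<in> I. (if x \<in> X then 1 else 0 :: nat) \<in> {1}}"
      using that by (auto simp: upset_def split: if_splits)
    moreover have "monotone_on I (\<lambda>x y. (x, y) \<in> r) (\<le>) (\<lambda>x. if x \<in> X then 1 else 0 :: nat)"
      using that by (auto simp: monotone_on_def upset_def)
    ultimately show ?thesis unfolding M_def by blast
  qed
  have M: "algebra I M"
    unfolding algebra_iff_Un
    using Un compl up[of "{}"] by (auto simp: M_def upset_def)
  have "ico I r s t \<in> M" for s t
  proof -
    let ?X = "{x \<in> I. s = Fin x \<or> ext_less r s (Fin x)}"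
    let ?Y = "{x \<in> I. \<not> ext_less r (Fin x) t}"
    have "upset I r ?X"
      by (cases s) (auto simp: upset_def dest: trans antisym)
    moreover have "upset I r ?Y"
      by (cases t) (use trans antisym in \<open>auto simp: upset_def\<close>)
    moreover have "ico I r s t = ?X - ?Y" by (auto simp: ico_def)
    ultimately show ?thesis
      by (simp only: ring_of_sets.Diff[OF algebra.axioms(1)[OF M]] up)
  qed
  then have "algebra I hull {ico I r s t | s t. s \<in> endpoints I \<and> t \<in> endpoints I} \<subseteq> M"
    by (intro hull_minimal) (auto simp: M)
  then have "a \<in> M"
    using a by (auto simp: interval_balg_def set_balg_def)
  then show ?thesis by (simp add: M_def)
qed

text \<open>The similar triples are taken from the up-sets \<open>U \<alpha> \<zeta> l\<close> on which the monotone map for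
  \<open>a \<alpha> \<zeta>\<close> exceeds \<open>l\<close>; they form a chain for each \<open>\<zeta>\<close>. A point at which the term does not vanish
  is in exactly one of the elements number 1 and 2, and in exactly one of number 4 and 5. Hence it
  has the same position in the elements number 0 and 3, and so it cannot be in only one of these.\<close>

lemma tau6_vanishes_somewhere:
  fixes \<kappa> :: "'k rel" and B :: "'k \<Rightarrow> 'i set balg"
  defines "L \<equiv> cardSuc (ctwo ^c \<kappa>)"
  assumes \<kappa>: "Cinfinite \<kappa>"
    and B: "\<And>\<zeta>. \<zeta> \<in> Field \<kappa> \<Longrightarrow> is_interval_balg (B \<zeta>)"
    and a: "\<And>\<alpha>. \<alpha> \<in> Field L \<Longrightarrow> a \<alpha> \<in> carrier (prod_balg (Field \<kappa>) B)"
  shows "\<exists>\<alpha>s. length \<alpha>s = 6 \<and> set \<alpha>s \<subseteq> Field L \<and> sorted_wrt (\<lambda>\<alpha> \<beta>. (\<alpha>, \<beta>) \<in> L - Id) \<alpha>s \<and>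
           beval (prod_balg (Field \<kappa>) B) (map a \<alpha>s) tau6 = bzero (prod_balg (Field \<kappa>) B)"
proof -
  obtain I r where Ir: "\<And>\<zeta>. \<zeta> \<in> Field \<kappa> \<Longrightarrow> linear_order_on (I \<zeta>) (r \<zeta>)"
      "\<And>\<zeta>. \<zeta> \<in> Field \<kappa> \<Longrightarrow> B \<zeta> = interval_balg (I \<zeta>) (r \<zeta>)"
    using B unfolding is_interval_balg_def by metis
  define fibres where "fibres \<zeta> A M s \<longleftrightarrow>
      monotone_on (I \<zeta>) (\<lambda>x y. (x, y) \<in> r \<zeta>) (\<le>) M \<and> A = {x \<in> I \<zeta>. M x \<in> s}"
    for \<zeta> A and M :: "'i \<Rightarrow> nat" and s
  have "\<exists>M s. fibres \<zeta> (a \<alpha> \<zeta>) M s" if "\<alpha> \<in> Field L" "\<zeta> \<in> Field \<kappa>" for \<alpha> \<zeta>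
  proof -
    have "a \<alpha> \<zeta> \<in> carrier (B \<zeta>)"
      using a[OF that(1)] that(2) by (auto simp: prod_balg_def)
    then show ?thesis
      unfolding fibres_def using interval_balg_monotone_fibres Ir[OF that(2)] by simp
  qed
  then obtain N p where "\<And>\<alpha> \<zeta>. \<alpha> \<in> Field L \<Longrightarrow> \<zeta> \<in> Field \<kappa> \<Longrightarrow> fibres \<zeta> (a \<alpha> \<zeta>) (N \<alpha> \<zeta>) (p \<alpha> \<zeta>)"
    by metis
  then have N: "\<And>\<alpha> \<zeta>. \<alpha> \<in> Field L \<Longrightarrow> \<zeta> \<in> Field \<kappa> \<Longrightarrow>
        monotone_on (I \<zeta>) (\<lambda>x y. (x, y) \<in> r \<zeta>) (\<le>) (N \<alpha> \<zeta>)"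
      "\<And>\<alpha> \<zeta>. \<alpha> \<in> Field L \<Longrightarrow> \<zeta> \<in> Field \<kappa> \<Longrightarrow> a \<alpha> \<zeta> = {x \<in> I \<zeta>. N \<alpha> \<zeta> x \<in> p \<alpha> \<zeta>}"
    by (simp_all add: fibres_def)
  define U where "U \<alpha> \<zeta> l = {x \<in> I \<zeta>. l < N \<alpha> \<zeta> x}" for \<alpha> \<zeta> l
  have U_upset: "upset (I \<zeta>) (r \<zeta>) (U \<alpha> \<zeta> l)" if "\<alpha> \<in> Field L" "\<zeta> \<in> Field \<kappa>" for \<alpha> \<zeta> l
    using N(1)[OF that] by (auto simp: upset_def U_def monotone_on_def intro: less_le_trans)
  have U_dec: "U \<alpha> \<zeta> (Suc l) \<subseteq> U \<alpha> \<zeta> l" for \<alpha> \<zeta> l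
    by (auto simp: U_def)
  obtain \<alpha>s where \<alpha>s: "length \<alpha>s = 6" "set \<alpha>s \<subseteq> Field L"
      "sorted_wrt (\<lambda>\<alpha> \<beta>. (\<alpha>, \<beta>) \<in> L - Id) \<alpha>s"
    and same: "\<And>\<zeta>. \<zeta> \<in> Field \<kappa> \<Longrightarrow> \<exists>P. \<forall>\<alpha>\<in>set \<alpha>s. p \<alpha> \<zeta> = P"
    and similar: "\<And>\<zeta>. \<zeta> \<in> Field \<kappa> \<Longrightarrow>
      similar_triples {V. \<exists>\<alpha>\<in>Field L. V \<in> range (U \<alpha> \<zeta>)} (\<lambda>j. U (\<alpha>s ! j) \<zeta>)"
    using exist_similar_triples[OF \<kappa>, of U p, folded L_def] U_dec by auto
  have nth: "\<alpha>s ! j \<in> set \<alpha>s" "\<alpha>s ! j \<in> Field L" if "j < 6" for j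
    using that \<alpha>s(1,2) by auto
  have pointwise: False
    if \<zeta>: "\<zeta> \<in> Field \<kappa>" and "y \<in> a (\<alpha>s ! 0) \<zeta>" "y \<in> a (\<alpha>s ! 1) \<zeta>" "y \<notin> a (\<alpha>s ! 2) \<zeta>"
      "y \<notin> a (\<alpha>s ! 3) \<zeta>" "y \<in> a (\<alpha>s ! 4) \<zeta>" "y \<notin> a (\<alpha>s ! 5) \<zeta>" for \<zeta> y
  proof -
    have y: "y \<in> I \<zeta>" using that N(2)[OF nth(2) \<zeta>, of 0] by auto
    obtain P where P: "\<forall>\<alpha>\<in>set \<alpha>s. p \<alpha> \<zeta> = P" using same[OF \<zeta>] by blast
    have mem: "y \<in> a (\<alpha>s ! j) \<zeta> \<longleftrightarrow> N (\<alpha>s ! j) \<zeta> y \<in> P" if "j < 6" for j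
      using N(2)[OF nth(2)[OF that] \<zeta>] P nth(1)[OF that] y by simp
    have "N (\<alpha>s ! 0) \<zeta> y = N (\<alpha>s ! 3) \<zeta> y"
    proof (rule positions_agree[OF _ _ _ similar[OF \<zeta>], where n = "\<lambda>j. N (\<alpha>s ! j) \<zeta> y" and y = y])
      show "X \<subseteq> Y \<or> Y \<subseteq> X" if "X \<in> {V. \<exists>\<alpha>\<in>Field L. V \<in> range (U \<alpha> \<zeta>)}"
          "Y \<in> {V. \<exists>\<alpha>\<in>Field L. V \<in> range (U \<alpha> \<zeta>)}" for X Y
        using that upsets_chain[OF Ir(1)[OF \<zeta>]] U_upset[OF _ \<zeta>] by blast
      show "U (\<alpha>s ! j) \<zeta> l \<in> {V. \<exists>\<alpha>\<in>Field L. V \<in> range (U \<alpha> \<zeta>)}" if "j < 6" for j l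
        using nth(2)[OF that] by blast
      show "y \<in> U (\<alpha>s ! j) \<zeta> l \<longleftrightarrow> l < N (\<alpha>s ! j) \<zeta> y" for j l
        using y by (simp add: U_def)
      show "N (\<alpha>s ! 1) \<zeta> y \<noteq> N (\<alpha>s ! 2) \<zeta> y" "N (\<alpha>s ! 4) \<zeta> y \<noteq> N (\<alpha>s ! 5) \<zeta> y"
        using that mem[of 1] mem[of 2] mem[of 4] mem[of 5] by auto
    qed
    then show False using that mem[of 0] mem[of 3] by auto
  qed
  have "beval (prod_balg (Field \<kappa>) B) (map a \<alpha>s) tau6 = bzero (prod_balg (Field \<kappa>) B)"
    unfolding tau6_def
    using \<alpha>s(1) pointwise
    by (auto simp: prod_balg_def Ir(2) interval_balg_def set_balg_def intro!: restrict_ext)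
  then show ?thesis using \<alpha>s by blast
qed

lemma nontrivial_tau6: "nontrivial_bterm 6 tau6"
proof -
  let ?B = "set_balg (UNIV :: unit set) UNIV" and ?as = "[UNIV, UNIV, {}, {}, UNIV, {}] :: unit set list"
  have "algebra (UNIV :: unit set) UNIV" by (auto simp: algebra_iff_Un)
  then have "nontrivial_bterm (length ?as) tau6"
    by (intro nontrivial_btermI[OF bool_alg_set_balg])
      (auto simp: set_balg_def tau6_def)
  moreover have "length ?as = 6" by simp
  ultimately show ?thesis by metis
qed

section \<open>Nontrivial terms are satisfiable by truth values\<close>

primrec holds :: "(nat \<Rightarrow> bool) \<Rightarrow> bterm \<Rightarrow> bool" where
  "holds v (BVar i) \<longleftrightarrow> v i"
| "holds v BZero \<longleftrightarrow> False"
| "holds v BOne \<longleftrightarrow> True"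
| "holds v (BMeet \<sigma> \<tau>) \<longleftrightarrow> holds v \<sigma> \<and> holds v \<tau>"
| "holds v (BJoin \<sigma> \<tau>) \<longleftrightarrow> holds v \<sigma> \<or> holds v \<tau>"
| "holds v (BCompl \<tau>) \<longleftrightarrow> \<not> holds v \<tau>"

context bool_alg
begin

lemma meet_one: "x \<in> carrier B \<Longrightarrow> bmeet B x (bone B) = x"
  using meet_absorb[of x "bcompl B x"] join_compl[of x] compl_closed[of x] by simp

lemma join_zero: "x \<in> carrier B \<Longrightarrow> bjoin B x (bzero B) = x"
  using join_absorb[of x "bcompl B x"] meet_compl[of x] compl_closed[of x] by simp

lemma zero_meet: "x \<in> carrier B \<Longrightarrow> bmeet B (bzero B) x = bzero B"
  using meet_absorb[of "bzero B" x] join_comm[of x "bzero B"] join_zero[of x] zero_closed by simp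

lemma meet_zero: "x \<in> carrier B \<Longrightarrow> bmeet B x (bzero B) = bzero B"
  using zero_meet meet_comm zero_closed by simp

lemma meet_idem: "x \<in> carrier B \<Longrightarrow> bmeet B x x = x"
  using meet_absorb[of x "bzero B"] join_zero zero_closed by simp

lemma join_idem: "x \<in> carrier B \<Longrightarrow> bjoin B x x = x"
  using join_absorb[of x "bone B"] meet_one one_closed by simp

text \<open>Below a nonzero element there is one that takes sides with respect to finitely many given
  elements: meet successively with each \<open>x\<close>, unless this gives zero. On the part below \<open>d\<close>, terms in
  these elements then evaluate like truth values. This avoids ultrafilters.\<close>

lemma refine_to_decide:
  assumes "c \<in> carrier B" "c \<noteq> bzero B" "set as \<subseteq> carrier B"
  shows "\<exists>d\<in>carrier B. d \<noteq> bzero B \<and> bmeet B d c = d \<and>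
           (\<forall>x\<in>set as. bmeet B d x = d \<or> bmeet B d x = bzero B)"
  using assms(3)
proof (induction as)
  case Nil
  then show ?case using assms meet_idem by auto
next
  case (Cons x as)
  then obtain d where d: "d \<in> carrier B" "d \<noteq> bzero B" "bmeet B d c = d"
      "\<forall>x\<in>set as. bmeet B d x = d \<or> bmeet B d x = bzero B"
    by auto
  have x: "x \<in> carrier B" using Cons by simp
  show ?case
  proof (cases "bmeet B d x = bzero B")
    case True
    then show ?thesis using d by auto
  next
    case False
    have swap: "bmeet B (bmeet B d x) z = bmeet B (bmeet B d z) x" if "z \<in> carrier B" for z
      using that x d(1) meet_assoc meet_comm[of x z] by simp
    have "bmeet B (bmeet B d x) x = bmeet B d x"
      using meet_assoc[of d x x] meet_idem x d(1) by simp
    moreover have "bmeet B (bmeet B d x) z = bmeet B d x \<or> bmeet B (bmeet B d x) z = bzero B"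
      if "z \<in> set as" for z
    proof -
      have "z \<in> carrier B" using that Cons by auto
      then show ?thesis using swap[of z] d(4) that zero_meet[OF x] by auto
    qed
    moreover have "bmeet B (bmeet B d x) c = bmeet B d x"
      using swap[OF assms(1)] d(3) by simp
    ultimately show ?thesis
      using False meet_closed[OF d(1) x] by (intro bexI[of _ "bmeet B d x"]) auto
  qed
qed

lemma decided_term:
  assumes d: "d \<in> carrier B" and as: "set as \<subseteq> carrier B"
    and dec: "\<forall>x\<in>set as. bmeet B d x = d \<or> bmeet B d x = bzero B"
    and "bvars \<tau> \<subseteq> {..<length as}"
  shows "bmeet B d (beval B as \<tau>) = (if holds (\<lambda>i. bmeet B d (as ! i) = d) \<tau> then d else bzero B)"
  using assms(4)
proof (induction \<tau>)
  case (BVar i)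
  then show ?case using dec by (auto simp: all_set_conv_all_nth)
next
  case (BMeet \<sigma> \<tau>)
  have "beval B as \<sigma> \<in> carrier B" "beval B as \<tau> \<in> carrier B"
    using BMeet.prems as bool_alg_axioms by (auto intro!: beval_closed)
  then show ?case
    using BMeet meet_assoc[of d "beval B as \<sigma>" "beval B as \<tau>", symmetric] d zero_meet by auto
next
  case (BJoin \<sigma> \<tau>)
  have "beval B as \<sigma> \<in> carrier B" "beval B as \<tau> \<in> carrier B"
    using BJoin.prems as bool_alg_axioms by (auto intro!: beval_closed)
  then show ?case
    using BJoin meet_distrib[of d "beval B as \<sigma>" "beval B as \<tau>"] d join_idem join_zero
      join_comm[of "bzero B" d] zero_closed by auto
next
  case (BCompl \<tau>)
  let ?x = "beval B as \<tau>"
  have x: "?x \<in> carrier B"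
    using BCompl.prems as bool_alg_axioms by (auto intro!: beval_closed)
  note IH = BCompl.IH[OF BCompl.prems[simplified]]
  show ?case
  proof (cases "holds (\<lambda>i. bmeet B d (as ! i) = d) \<tau>")
    case True
    then have "bmeet B d (bcompl B ?x) = bmeet B (bmeet B d ?x) (bcompl B ?x)"
      using IH by simp
    also have "\<dots> = bzero B"
      using meet_assoc[OF d x compl_closed[OF x]] meet_compl[OF x] meet_zero[OF d] by simp
    finally show ?thesis using True by simp
  next
    case False
    have "d = bmeet B d (bjoin B ?x (bcompl B ?x))"
      using join_compl[OF x] meet_one[OF d] by simp
    also have "\<dots> = bjoin B (bzero B) (bmeet B d (bcompl B ?x))"
      using meet_distrib[OF d x compl_closed[OF x]] IH False by simp
    also have "\<dots> = bmeet B d (bcompl B ?x)"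
      using join_comm[OF zero_closed] join_zero meet_closed[OF d compl_closed[OF x]] by simp
    finally show ?thesis using False by simp
  qed
qed (use d in \<open>simp_all add: meet_zero meet_one\<close>)

end

lemma nontrivial_bterm_satisfiable:
  assumes "nontrivial_bterm n \<tau>" shows "\<exists>v. holds v \<tau>"
proof -
  obtain B :: "nat balg" and as where B: "bool_alg B" "length as = n" "set as \<subseteq> carrier B"
      "beval B as \<tau> \<noteq> bzero B" and vars: "bvars \<tau> \<subseteq> {..<length as}"
    using assms by (auto simp: nontrivial_bterm_def)
  interpret bool_alg B by fact
  have "beval B as \<tau> \<in> carrier B"
    by (rule beval_closed[OF B(1,3) vars])
  from refine_to_decide[OF this B(4,3)] obtain d where d: "d \<in> carrier B" "d \<noteq> bzero B"
      "bmeet B d (beval B as \<tau>) = d" "\<forall>x\<in>set as. bmeet B d x = d \<or> bmeet B d x = bzero B"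
    by blast
  have "holds (\<lambda>i. bmeet B d (as ! i) = d) \<tau>"
    using decided_term[OF d(1) B(3) d(4) vars] d(2,3) by (auto split: if_splits)
  then show ?thesis by blast
qed

section \<open>An independent set of size \<open>2\<^sup>\<kappa>\<close>\<close>

text \<open>The Fichtenholz-Kantorovich-Hausdorff construction of \<open>2\<^sup>|\<^sup>K\<^sup>|\<close> independent subsets of \<open>K\<close>:
  up to an injection into \<open>K\<close>, the set \<open>X S\<close> consists of all pairs \<open>(F, \<F>)\<close> of a finite set and a
  finite family of finite sets with \<open>S \<inter> F \<in> \<F>\<close>. Given finitely many sets, choose \<open>F\<close> so large
  that they have different traces on \<open>F\<close>; then \<open>\<F>\<close> can select any of the traces.\<close>

lemma independent_subsets:
  fixes K :: "'k set"
  assumes "infinite K"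
  shows "\<exists>X :: 'k set \<Rightarrow> 'k set. \<forall>Ss v. distinct Ss \<longrightarrow> set Ss \<subseteq> Pow K \<longrightarrow>
    (\<exists>\<zeta>\<in>K. \<forall>i<length Ss. \<zeta> \<in> X (Ss ! i) \<longleftrightarrow> v i)"
proof -
  define Z where "Z = Fpow K \<times> Fpow (Fpow K)"
  have "|Fpow K| \<le>o |K|" by (rule card_of_Fpow_le[OF assms])
  have "infinite ((\<lambda>x. {x}) ` K)"
    using assms by (simp add: finite_image_iff)
  moreover have "(\<lambda>x. {x}) ` K \<subseteq> Fpow K" by (auto simp: Fpow_def)
  ultimately have "infinite (Fpow K)" by (rule infinite_super[rotated])
  then have "|Fpow (Fpow K)| \<le>o |K|"
    using ordLeq_transitive[OF card_of_Fpow_le \<open>|Fpow K| \<le>o |K|\<close>] by blast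
  then have "|Z| \<le>o |K|"
    unfolding Z_def using \<open>|Fpow K| \<le>o |K|\<close> by (intro card_of_Sigma_ordLeq_infinite[OF assms]) auto
  then obtain e where e: "inj_on e Z" "e ` Z \<subseteq> K"
    unfolding card_of_ordLeq[symmetric] by blast
  define X where "X S = {e (F, \<F>) | F \<F>. (F, \<F>) \<in> Z \<and> S \<inter> F \<in> \<F>}" for S
  have "\<exists>\<zeta>\<in>K. \<forall>i<length Ss. \<zeta> \<in> X (Ss ! i) \<longleftrightarrow> v i"
    if Ss: "distinct Ss" "set Ss \<subseteq> Pow K" for Ss and v :: "nat \<Rightarrow> bool"
  proof -
    define x where "x S T = (SOME x. x \<in> (S - T) \<union> (T - S))" for S T :: "'k set"
    have x: "x S T \<in> (S - T) \<union> (T - S)" if "S \<noteq> T" for S T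
      unfolding x_def by (rule someI_ex) (use that in blast)
    define F where "F = {x S T | S T. S \<in> set Ss \<and> T \<in> set Ss \<and> S \<noteq> T}"
    define \<F> where "\<F> = {Ss ! i \<inter> F | i. i < length Ss \<and> v i}"
    have "F \<subseteq> (\<lambda>(S, T). x S T) ` (set Ss \<times> set Ss)" unfolding F_def by auto
    then have "finite F" by (rule finite_subset) simp
    moreover have "F \<subseteq> K" using x Ss(2) unfolding F_def by blast
    ultimately have F: "F \<in> Fpow K" by (simp add: Fpow_def)
    have "\<F> \<in> Fpow (Fpow K)"
      using \<open>finite F\<close> \<open>F \<subseteq> K\<close> by (auto simp: Fpow_def \<F>_def)
    then have Z: "(F, \<F>) \<in> Z" using F by (simp add: Z_def)
    have "e (F, \<F>) \<in> X (Ss ! i) \<longleftrightarrow> v i" if i: "i < length Ss" for i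
    proof -
      have "e (F, \<F>) \<in> X (Ss ! i) \<longleftrightarrow> Ss ! i \<inter> F \<in> \<F>"
        unfolding X_def using Z inj_onD[OF e(1)] by blast
      also have "\<dots> \<longleftrightarrow> v i"
      proof
        assume "Ss ! i \<inter> F \<in> \<F>"
        then obtain j where j: "j < length Ss" "v j" "Ss ! i \<inter> F = Ss ! j \<inter> F"
          by (auto simp: \<F>_def)
        have "Ss ! i = Ss ! j"
        proof (rule ccontr)
          assume ne: "Ss ! i \<noteq> Ss ! j"
          then have "x (Ss ! i) (Ss ! j) \<in> F"
            unfolding F_def using nth_mem[OF i] nth_mem[OF j(1)] by blast
          then show False using x[OF ne] j(3) by blast
        qed
        then show "v i" using j i Ss(1) nth_eq_iff_index_eq by blast
      qed (use i in \<open>auto simp: \<F>_def\<close>)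
      finally show ?thesis .
    qed
    moreover have "e (F, \<F>) \<in> K" using e(2) Z by blast
    ultimately show ?thesis by blast
  qed
  then show ?thesis by blast
qed

lemma beval_zero_one:
  assumes \<zeta>: "\<zeta> \<in> K" and B: "B \<zeta> = set_balg \<Omega> M"
    and as: "\<And>i. i < length as \<Longrightarrow> (as ! i) \<zeta> = (if v i then \<Omega> else {})"
    and "bvars \<tau> \<subseteq> {..<length as}"
  shows "beval (prod_balg K B) as \<tau> \<zeta> = (if holds v \<tau> then \<Omega> else {})"
  using assms(4) by (induction \<tau>) (use \<zeta> B as in \<open>auto simp: prod_balg_def set_balg_def\<close>)

text \<open>The independent elements take only the values zero and one in each coordinate, so a term is
  evaluated by truth values there; and every assignment of truth values is realized by some
  coordinate.\<close>

lemma large_independent_set: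
  fixes \<kappa> :: "'k rel" and B :: "'k \<Rightarrow> 'i set balg"
  assumes \<kappa>: "Cinfinite \<kappa>"
    and B: "\<And>\<zeta>. \<zeta> \<in> Field \<kappa> \<Longrightarrow> is_interval_balg (B \<zeta>) \<and> nontrivial_balg (B \<zeta>)"
  shows "\<exists>Y. independent_in (prod_balg (Field \<kappa>) B) Y \<and> |Y| =o ctwo ^c \<kappa>"
proof -
  let ?K = "Field \<kappa>" and ?P = "prod_balg (Field \<kappa>) B"
  have "infinite ?K" using \<kappa> by (simp add: cinfinite_def)
  then obtain X :: "'k set \<Rightarrow> 'k set" where X: "\<And>Ss v. distinct Ss \<Longrightarrow> set Ss \<subseteq> Pow ?K \<Longrightarrow>
      \<exists>\<zeta>\<in>?K. \<forall>i<length Ss. \<zeta> \<in> X (Ss ! i) \<longleftrightarrow> v i"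
    using independent_subsets by metis
  have "\<forall>\<zeta>\<in>?K. \<exists>\<Omega> M. B \<zeta> = set_balg \<Omega> M \<and> \<Omega> \<noteq> {}"
    using B unfolding is_interval_balg_def interval_balg_def nontrivial_balg_def set_balg_def
    by fastforce
  then obtain \<Omega> M where \<Omega>: "\<And>\<zeta>. \<zeta> \<in> ?K \<Longrightarrow> B \<zeta> = set_balg (\<Omega> \<zeta>) (M \<zeta>)" "\<And>\<zeta>. \<zeta> \<in> ?K \<Longrightarrow> \<Omega> \<zeta> \<noteq> {}"
    by metis
  define E where "E S = (\<lambda>\<zeta>\<in>?K. if \<zeta> \<in> X S then bone (B \<zeta>) else bzero (B \<zeta>))" for S
  have E: "E S \<zeta> = (if \<zeta> \<in> X S then \<Omega> \<zeta> else {})" if "\<zeta> \<in> ?K" for S \<zeta>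
    using that \<Omega>(1)[OF that] by (simp add: E_def set_balg_def)
  have carrier: "E S \<in> carrier ?P" for S
  proof -
    have "bzero (B \<zeta>) \<in> carrier (B \<zeta>) \<and> bone (B \<zeta>) \<in> carrier (B \<zeta>)" if "\<zeta> \<in> ?K" for \<zeta>
      using that B bool_alg_interval_balg bool_alg.zero_closed bool_alg.one_closed by blast
    then show ?thesis by (simp add: prod_balg_def E_def)
  qed
  have nonzero: "beval ?P (map E Ss) \<tau> \<noteq> bzero ?P"
    if "distinct Ss" "set Ss \<subseteq> Pow ?K" "nontrivial_bterm (length Ss) \<tau>" for Ss \<tau>
  proof -
    obtain v where v: "holds v \<tau>" using nontrivial_bterm_satisfiable \<open>nontrivial_bterm (length Ss) \<tau>\<close> by blast
    obtain \<zeta> where \<zeta>: "\<zeta> \<in> ?K" "\<And>i. i < length Ss \<Longrightarrow> \<zeta> \<in> X (Ss ! i) \<longleftrightarrow> v i"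
      using X[OF \<open>distinct Ss\<close> \<open>set Ss \<subseteq> Pow ?K\<close>, of v] by blast
    have "beval ?P (map E Ss) \<tau> \<zeta> = (if holds v \<tau> then \<Omega> \<zeta> else {})"
      by (rule beval_zero_one[where B = B and \<zeta> = \<zeta> and \<Omega> = "\<Omega> \<zeta>" and M = "M \<zeta>", OF \<zeta>(1) \<Omega>(1)[OF \<zeta>(1)]])
        (use \<zeta> E that(3) in \<open>auto simp: nontrivial_bterm_def\<close>)
    then show ?thesis
      using v \<zeta>(1) \<Omega>[OF \<zeta>(1)] by (auto simp: prod_balg_def set_balg_def)
  qed
  have inj: "inj_on E (Pow ?K)"
  proof (rule inj_onI, rule ccontr)
    fix S T assume ST: "S \<in> Pow ?K" "T \<in> Pow ?K" "E S = E T" "S \<noteq> T"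
    then obtain \<zeta> where \<zeta>: "\<zeta> \<in> ?K" "\<forall>i<length [S, T]. \<zeta> \<in> X ([S, T] ! i) \<longleftrightarrow> i = 0"
      using X[of "[S, T]" "\<lambda>i. i = 0"] by auto
    then have "\<zeta> \<in> X S" "\<zeta> \<notin> X T"
      using \<zeta>(2)[rule_format, of 0] \<zeta>(2)[rule_format, of 1] by simp_all
    then show False using E[OF \<zeta>(1), of S] E[OF \<zeta>(1), of T] ST(3) \<Omega>(2)[OF \<zeta>(1)] by simp
  qed
  have "independent_in ?P (E ` Pow ?K)"
    unfolding independent_in_def
  proof (intro conjI allI impI)
    show "E ` Pow ?K \<subseteq> carrier ?P" using carrier by blast
    fix as \<tau> assume as: "distinct as" "set as \<subseteq> E ` Pow ?K" "nontrivial_bterm (length as) \<tau>"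
    define Ss where "Ss = map (inv_into (Pow ?K) E) as"
    have "map E Ss = as"
      unfolding Ss_def map_map
      by (rule map_idI) (use as(2) in \<open>auto intro: f_inv_into_f\<close>)
    moreover have "distinct Ss"
      using as(1) calculation by (metis distinct_map)
    moreover have "set Ss \<subseteq> Pow ?K"
      using as(2) inv_into_into[of _ E "Pow ?K"] by (auto simp: Ss_def)
    ultimately show "beval ?P as \<tau> \<noteq> bzero ?P"
      using nonzero[of Ss \<tau>] as(3) by (metis length_map)
  qed
  moreover have "|E ` Pow ?K| =o ctwo ^c \<kappa>"
  proof -
    have "|E ` Pow ?K| =o |Pow ?K|"
      by (rule ordIso_symmetric[OF card_of_ordIsoI[OF inj_on_imp_bij_betw[OF inj]]])
    also have "|Pow ?K| =o |Func ?K (UNIV :: bool set)|" by (rule card_of_Pow_Func)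
    also have "|Func ?K (UNIV :: bool set)| = ctwo ^c \<kappa>"
      by (simp add: cexp_def ctwo_def Field_card_of)
    finally show ?thesis .
  qed
  ultimately show ?thesis by blast
qed

section \<open>The independence number\<close>

lemma independent_card_le:
  fixes \<kappa> :: "'k rel" and B :: "'k \<Rightarrow> 'i set balg"
  assumes \<kappa>: "Cinfinite \<kappa>"
    and B: "\<And>\<zeta>. \<zeta> \<in> Field \<kappa> \<Longrightarrow> is_interval_balg (B \<zeta>)"
    and Y: "independent_in (prod_balg (Field \<kappa>) B) Y"
  shows "|Y| \<le>o ctwo ^c \<kappa>"
proof (rule ccontr)
  let ?\<mu> = "ctwo ^c \<kappa>" and ?P = "prod_balg (Field \<kappa>) B"
  have \<mu>: "Card_order ?\<mu>" by (rule Card_order_cexp)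
  assume "\<not> |Y| \<le>o ?\<mu>"
  then have "?\<mu> <o |Y|"
    using not_ordLeq_iff_ordLess[OF conjunct1[OF \<mu>[unfolded card_order_on_def]] card_of_Well_order] by blast
  then have "cardSuc ?\<mu> \<le>o |Y|"
    using \<mu> by (simp add: cardSuc_ordLess_ordLeq card_of_Card_order)
  then have "|Field (cardSuc ?\<mu>)| \<le>o |Field |Y| |"
    by (rule card_of_mono2)
  then obtain g where g: "inj_on g (Field (cardSuc ?\<mu>))" "g ` Field (cardSuc ?\<mu>) \<subseteq> Y"
    unfolding Field_card_of card_of_ordLeq[symmetric] by blast
  then have "g \<alpha> \<in> carrier ?P" if "\<alpha> \<in> Field (cardSuc ?\<mu>)" for \<alpha>
    using that Y by (auto simp: independent_in_def)
  from tau6_vanishes_somewhere[where B = B and a = g, OF \<kappa> B this] obtain \<alpha>s where \<alpha>s: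
      "length \<alpha>s = 6" "set \<alpha>s \<subseteq> Field (cardSuc ?\<mu>)"
      "sorted_wrt (\<lambda>\<alpha> \<beta>. (\<alpha>, \<beta>) \<in> cardSuc ?\<mu> - Id) \<alpha>s"
      "beval ?P (map g \<alpha>s) tau6 = bzero ?P"
    by blast
  have "distinct \<alpha>s"
    unfolding distinct_conv_nth
    using sorted_wrt_nth_less[OF \<alpha>s(3)] by (metis DiffD2 IdI linorder_neqE_nat)
  then have "distinct (map g \<alpha>s)"
    using g(1) \<alpha>s(2) by (auto simp: distinct_map intro: inj_on_subset)
  moreover have "set (map g \<alpha>s) \<subseteq> Y" using g(2) \<alpha>s(2) by auto
  moreover have "nontrivial_bterm (length (map g \<alpha>s)) tau6" using \<alpha>s(1) nontrivial_tau6 by simp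
  ultimately show False using Y \<alpha>s(4) unfolding independent_in_def by blast
qed

theorem theorem1p1:
  fixes \<kappa> :: "'k rel" and B :: "'k \<Rightarrow> 'i set balg"
  assumes "Cinfinite \<kappa>"
    and "\<And>\<zeta>. \<zeta> \<in> Field \<kappa> \<Longrightarrow> is_interval_balg (B \<zeta>) \<and> nontrivial_balg (B \<zeta>)"
  shows "Ind (prod_balg (Field \<kappa>) B) =o ctwo ^c \<kappa>
    \<and> (\<exists>n \<tau>. nontrivial_bterm n \<tau> \<and>
        (\<forall>a. (\<forall>\<alpha>\<in>Field (cardSuc (ctwo ^c \<kappa>)). a \<alpha> \<in> carrier (prod_balg (Field \<kappa>) B)) \<longrightarrow>
          (\<exists>\<alpha>s. length \<alpha>s = n \<and> set \<alpha>s \<subseteq> Field (cardSuc (ctwo ^c \<kappa>)) \<and>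
             sorted_wrt (\<lambda>\<alpha> \<beta>. (\<alpha>, \<beta>) \<in> cardSuc (ctwo ^c \<kappa>) - Id) \<alpha>s \<and>
             beval (prod_balg (Field \<kappa>) B) (map a \<alpha>s) \<tau> = bzero (prod_balg (Field \<kappa>) B))))
    \<and> nontrivial_bterm 6 tau6 \<and>
        (\<forall>a. (\<forall>\<alpha>\<in>Field (cardSuc (ctwo ^c \<kappa>)). a \<alpha> \<in> carrier (prod_balg (Field \<kappa>) B)) \<longrightarrow>
          (\<exists>\<alpha>s. length \<alpha>s = 6 \<and> set \<alpha>s \<subseteq> Field (cardSuc (ctwo ^c \<kappa>)) \<and>
             sorted_wrt (\<lambda>\<alpha> \<beta>. (\<alpha>, \<beta>) \<in> cardSuc (ctwo ^c \<kappa>) - Id) \<alpha>s \<and>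
             beval (prod_balg (Field \<kappa>) B) (map a \<alpha>s) tau6 = bzero (prod_balg (Field \<kappa>) B)))"
    (is "?Ind \<and> (\<exists>n \<tau>. nontrivial_bterm n \<tau> \<and> ?vanishes n \<tau>) \<and> nontrivial_bterm 6 tau6 \<and> ?vanishes 6 tau6")
proof -
  let ?P = "prod_balg (Field \<kappa>) B"
  have interval: "\<And>\<zeta>. \<zeta> \<in> Field \<kappa> \<Longrightarrow> is_interval_balg (B \<zeta>)" using assms(2) by blast
  have tau6: "?vanishes 6 tau6"
    by (intro allI impI tau6_vanishes_somewhere[OF assms(1) interval]) auto
  have "Ind ?P \<le>o ctwo ^c \<kappa>"
    by (rule Ind_least[OF Card_order_cexp]) (rule independent_card_le[OF assms(1) interval])
  moreover have "ctwo ^c \<kappa> \<le>o Ind ?P"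
  proof -
    obtain Y where "independent_in ?P Y" "|Y| =o ctwo ^c \<kappa>"
      using large_independent_set[where B = B, OF assms] by blast
    then show ?thesis
      using ordIso_ordLeq_trans[OF ordIso_symmetric Ind_upper] by blast
  qed
  ultimately have ?Ind by (simp add: ordIso_iff_ordLeq)
  then show ?thesis using tau6 nontrivial_tau6 by blast
qed

end
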